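(* Assume (a.1)–(a.5). For $\varepsilon>0$ and $\beta\in\mathbb{R}$ let \[ K_{\varepsilon,\beta}(x)=\begin{cases}\dfrac{e^{i\gamma(x)}}{x^{1+i\beta}\psi(x)^{-i\beta}}, & \varepsilon\le x\le 1,\\[1ex] 0,&\text{otherwise},\end{cases} \] and $T_{\varepsilon,\beta}f=K_{\varepsilon,\beta}*f$. Then there exists a constant $A$, independent of $\varepsilon$ and $\beta$, such that for all $f\in L^1(\mathbb{R})$ and all $\alpha>0$, \[ |\{x\in\mathbb{R}:|T_{\varepsilon,\beta}f(x)|>\alpha\}|\le\frac{A(1+|\beta|)}{\alpha}\|f\|_{L^1(\mathbb{R})}. \]
   Context: Standing assumptions: $\gamma\in C^3((0,1])$ is real-valued with $\lim_{t\to0^+}|\gamma(t)|=\infty$, and $\psi\in C^2([0,1])$ is positive on $(0,1]$ with $\lim_{t\to0^+}\psi(t)=0$. There are constants $t_0,s_0,C>0$ such that: (a.1) $\gamma,\psi,\gamma',\gamma'',\psi'$ are all monotone; moreover $\gamma'(t)>0$ and $\gamma'$ is decreasing on $(0,1]$. (Hence $\gamma'$ has an inverse $\gamma'^{-1}(s)$ for $s\ge\gamma'(1)$.) (a.2) For $0<t<t_0$: $\left|\frac{\psi'(t)}{\psi(t)}\right|\le\frac12\left|\frac{\gamma'''(t)}{\gamma''(t)}\right|$. (a.3) For $s>s_0$: $|\gamma''(\gamma'^{-1}(2s))|\le C|\gamma''(\gamma'^{-1}(s))|$. (a.4) There exist $\epsilon>0$ and $A>1+\epsilon$ such that $\gamma'(t)\ge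 A\gamma'((1+\epsilon)t)$ for $0<t<t_0$. (a.5) There exists $1/2<\lambda<1$ such that $|\gamma''(t)|\le C\gamma'(t)^{2\lambda}$ for $0<t<t_0$. *)

theory Defs
  imports "HOL-Analysis.Analysis"
begin

definition monotone_either :: "real set \<Rightarrow> (real \<Rightarrow> real) \<Rightarrow> bool" where
  "monotone_either S f \<longleftrightarrow> mono_on S f \<or> antimono_on S f"

definition K_kernel ::
  "(real \<Rightarrow> real) \<Rightarrow> (real \<Rightarrow> real) \<Rightarrow> real \<Rightarrow> real \<Rightarrow> real \<Rightarrow> complex" where
  "K_kernel \<gamma> \<psi> \<epsilon> \<beta> x =
     (if \<epsilon> \<le> x \<and> x \<le> 1 then
        exp (\<i> * complex_of_real (\<gamma> x)) /
        (complex_of_real x powr (1 + \<i> * complex_of_real \<beta>) *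
         complex_of_real (\<psi> x) powr (- \<i> * complex_of_real \<beta>))
      else 0)"

definition T_op ::
  "(real \<Rightarrow> real) \<Rightarrow> (real \<Rightarrow> real) \<Rightarrow> real \<Rightarrow> real \<Rightarrow> (real \<Rightarrow> complex) \<Rightarrow> real \<Rightarrow> complex" where
  "T_op \<gamma> \<psi> \<epsilon> \<beta> f x = (LINT y|lborel. K_kernel \<gamma> \<psi> \<epsilon> \<beta> (x - y) * f y)"

definition L1_norm :: "(real \<Rightarrow> complex) \<Rightarrow> real" where
  "L1_norm f = (LINT y|lborel. norm (f y))"

end

theory Submission
  imports Defs
begin

text \<open>
  Neither cancellation nor the Fourier transform is needed: everything follows from bounds on the
  correlations \<open>\<integral> K (r + u) cnj (K r) dr\<close> over half-lines \<open>r > c\<close>. Trivially they are at most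
  \<open>1 / c\<close>. Since \<open>\<gamma>'\<close> grows faster than \<open>1 / t\<close> near \<open>0\<close>, by (a.4), an integration by parts for small
  \<open>r\<close> and the trivial bound for the other \<open>r\<close> give \<open>O((1 + |\<beta>|) u powr (-\<theta>))\<close> for some \<open>\<theta> < 1\<close>, with
  no loss as \<open>\<epsilon> \<rightarrow> 0\<close>.

  Let \<open>h y\<close> be the length of the largest dyadic interval of length at most \<open>1\<close> around \<open>y\<close> on which
  \<open>|f|\<close> has mean above \<open>\<alpha>\<close>, or a length below \<open>\<epsilon>\<close> if there is none. Off a set of measure at most
  \<open>2 \<parallel>f\<parallel> / \<alpha>\<close> nothing changes if the kernel \<open>K (x - y)\<close> is restricted to \<open>x - y > h y\<close>. Expanding the
  square of the \<open>L\<^sup>2\<close> norm of the restricted operator gives a double integral of \<open>|f y| |f z|\<close> times a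
  correlation which is at most a multiple of \<open>1 / h\<close> for \<open>|y - z| \<le> h / 2\<close> and of \<open>|y - z| powr (-\<theta>)\<close>
  beyond, where \<open>h = max (h y) (h z)\<close>. Intervals of length at least \<open>h\<close> carry \<open>|f|\<close>-mass \<open>O(\<alpha>)\<close>
  times their length on the points with stopping length at most \<open>h\<close>, so the square of the norm is
  \<open>O((1 + |\<beta>|) \<alpha> \<parallel>f\<parallel>)\<close>, and Chebyshev's inequality concludes.
\<close>

subsection \<open>Oscillatory correlation integrals\<close>

lemma has_real_derivative_shift:
  fixes f :: "real \<Rightarrow> real"
  assumes "(f has_real_derivative D) (at (r + u) within T)" "\<And>x. x \<in> S \<Longrightarrow> x + u \<in> T"
  shows "((\<lambda>x. f (x + u)) has_real_derivative D) (at r within S)"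
proof -
  have "(f has_real_derivative D) (at (r + u) within (\<lambda>x. x + u) ` S)"
    using assms by (auto intro: has_field_derivative_subset)
  moreover have "((\<lambda>x. x + u) has_real_derivative 1) (at r within S)"
    by (auto intro!: derivative_eq_intros)
  ultimately show ?thesis
    using DERIV_image_chain[of f D "\<lambda>x. x + u" r S 1] by (simp add: o_def)
qed

text \<open>Integration by parts against \<open>w = 1 / (r (r + u) (g1 r - g1 (r + u)))\<close>, the amplitude divided by
  the main part of the phase derivative. The \<open>\<beta>\<close>-dependent part of the phase enters only the
  remainder, and therefore only linearly.\<close>

lemma correlation_integral_near_zero:
  fixes g g1 g2 L p V :: "real \<Rightarrow> real"
  assumes dg: "\<And>t. t \<in> {0<..1} \<Longrightarrow> (g has_real_derivative g1 t) (at t within {0<..1})"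
    and dg1: "\<And>t. t \<in> {0<..1} \<Longrightarrow> (g1 has_real_derivative g2 t) (at t within {0<..1})"
    and dL: "\<And>t. t \<in> {0<..1} \<Longrightarrow> (L has_real_derivative p t) (at t within {0<..1})"
    and dV: "\<And>t. t \<in> {0<..1} \<Longrightarrow>
               (V has_real_derivative \<bar>p t\<bar> * g1 t powr (-\<kappa>)) (at t within {0<..1})"
    and V_bounds: "\<And>t. t \<in> {0<..1} \<Longrightarrow> - M \<le> V t \<and> V t \<le> 0"
    and g2_mono: "mono_on {0<..1} g2"
    and g1_pos: "\<And>t. t \<in> {0<..1} \<Longrightarrow> g1 t > 0"
    and g1_anti: "antimono_on {0<..1} g1"
    and gap: "\<And>r u. 0 < r \<Longrightarrow> r \<le> t1 \<Longrightarrow> 0 < u \<Longrightarrow> r + u \<le> 1 \<Longrightarrow>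
                c0 * u * g1 r \<le> (r + u) * (g1 r - g1 (r + u))"
    and growth: "\<And>r. 0 < r \<Longrightarrow> r \<le> t1 \<Longrightarrow> 1 / g1 r \<le> C1 * r powr b * g1 r powr (-\<kappa>)"
    and params: "b > 1" "\<kappa> \<ge> 0" "c0 > 0" "C1 > 0" "t1 \<le> 1"
    and cd: "0 < c" "c \<le> d" "d \<le> t1" "d + u \<le> 1" "u > 0"
  shows "norm (integral {c..d} (\<lambda>r. cis ((g (r+u) - \<beta> * ln (r+u) + \<beta> * L (r+u)) - (g r - \<beta> * ln r + \<beta> * L r))
            / of_real (r * (r + u))))
         \<le> C1 / c0 * (3 * g1 1 powr (-\<kappa>) + 4 * g1 1 powr (-\<kappa>) / (b - 1) + 2 * M) * (1 + \<bar>\<beta>\<bar>) * (d powr (b - 1) / u)"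
proof -
  define \<Theta> where "\<Theta> r = (g (r+u) - \<beta> * ln (r+u) + \<beta> * L (r+u)) - (g r - \<beta> * ln r + \<beta> * L r)" for r
  define Q where "Q = g1 1 powr (-\<kappa>)"
  define C2 where "C2 = C1 / c0"
  define D where "D r = g1 r - g1 (r + u)" for r
  define D' where "D' r = g2 r - g2 (r + u)" for r
  define P where "P r = r * (r + u)" for r
  define w where "w r = 1 / (P r * D r)" for r
  define w' where "w' r = - ((2 * r + u) * D r + P r * D' r) / (P r * D r)\<^sup>2" for r
  define s where "s r = p (r + u) - p r - 1 / (r + u) + 1 / r" for r
  \<comment> \<open>\<open>F\<close> is the integrated term: since the phase has derivative
    \<open>- D + \<beta> * s\<close> and \<open>D * w = 1 / P\<close>, its derivative is
    \<open>E\<close> plus the remainder \<open>R\<close>.\<close>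
  define F where "F r = \<i> * cis (\<Theta> r) * of_real (w r)" for r
  define E where "E r = cis (\<Theta> r) / complex_of_real (P r)" for r
  define R where "R r = cis (\<Theta> r) * (\<i> * of_real (w' r) - of_real (\<beta> * s r * w r))" for r
  \<comment> \<open>Built so that \<open>H'\<close> dominates \<open>norm R\<close>: the leading
    \<open>w\<close> yields \<open>w'\<close>, the power absorbs the multiples of
    \<open>w / r\<close>, and the two copies of \<open>V\<close> absorb
    \<open>\<bar>p\<bar> * w\<close> at \<open>r\<close> and at \<open>r + u\<close>.\<close>
  define H where "H r = w r + C2 / u * ((4 + \<bar>\<beta>\<bar>) * Q * (r powr (b - 1) / (b - 1))
                    + \<bar>\<beta>\<bar> * d powr (b - 1) * (V r + V (r + u)))" for r
  define H' where "H' r = w' r + C2 / u * ((4 + \<bar>\<beta>\<bar>) * Q * r powr (b - 2)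
                    + \<bar>\<beta>\<bar> * d powr (b - 1) * (\<bar>p r\<bar> * g1 r powr (-\<kappa>) + \<bar>p (r + u)\<bar> * g1 (r + u) powr (-\<kappa>)))" for r
  have C2: "C2 > 0" using params by (simp add: C2_def)
  have Q: "Q > 0" using g1_pos[of 1] by (simp add: Q_def)
  have rng: "r \<in> {0<..1}" "r + u \<in> {0<..1}" "0 < r" "r \<le> t1" "r + u \<le> 1" "r \<le> d" if "r \<in> {c..d}" for r
    using that cd params by auto
  have sub: "{c..d} \<subseteq> {0<..1}" and sh: "\<And>x. x \<in> {c..d} \<Longrightarrow> x + u \<in> {0<..1}"
    using rng(1,2) by blast+
  note der = has_field_derivative_subset[OF _ sub] 
  note dersh = has_real_derivative_shift[where S = "{c..d}" and u = u, OF _ sh]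
  have Dpos: "D r > 0" if "r \<in> {c..d}" for r
  proof -
    have "0 < c0 * u * g1 r" using params cd g1_pos rng[OF that] by simp
    also have "\<dots> \<le> (r + u) * D r" unfolding D_def using gap rng[OF that] cd by blast
    finally show ?thesis using rng[OF that] cd by (simp add: zero_less_mult_iff)
  qed
  have Ppos: "P r > 0" if "r \<in> {c..d}" for r using rng[OF that] by (simp add: P_def)
  have wpos: "w r > 0" if "r \<in> {c..d}" for r using Ppos[OF that] Dpos[OF that] by (simp add: w_def)
  have w_le: "w r \<le> C2 / u * r powr (b - 1) * g1 r powr (-\<kappa>)" if r: "r \<in> {c..d}" for r
  proof -
    have "w r \<le> 1 / (r * (c0 * u * g1 r))"
    proof -
      have "r * (c0 * u * g1 r) \<le> r * ((r + u) * D r)"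
        using gap[of r u] rng[OF r] cd by (intro mult_left_mono) (auto simp: D_def)
      moreover have "r * (c0 * u * g1 r) > 0" using params cd g1_pos rng[OF r] by simp
      ultimately show ?thesis unfolding w_def P_def by (intro frac_le) (auto simp: mult.assoc)
    qed
    also have "\<dots> = (1 / (c0 * u * r)) * (1 / g1 r)" by simp
    also have "\<dots> \<le> (1 / (c0 * u * r)) * (C1 * r powr b * g1 r powr (-\<kappa>))"
      using growth[of r] rng[OF r] cd params by (intro mult_left_mono) auto
    also have "\<dots> = C2 / u * (r powr b / r) * g1 r powr (-\<kappa>)"
      by (simp add: C2_def)
    also have "r powr b / r = r powr (b - 1)"
      using rng[OF r] by (simp add: powr_diff)
    finally show ?thesis .
  qed
  have g1_powr: "g1 r powr (-\<kappa>) \<le> g1 t powr (-\<kappa>)" if "r \<in> {0<..1}" "t \<in> {0<..1}" "r \<le> t" for r t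
    using that params g1_anti g1_pos
    by (intro powr_mono2') (auto simp: monotone_on_def)
  have g1Q: "g1 r powr (-\<kappa>) \<le> Q" if "r \<in> {0<..1}" for r
    using g1_powr[of r 1] that by (simp add: Q_def)
  have dw: "(w has_real_derivative w' r) (at r within {c..d})" if r: "r \<in> {c..d}" for r
  proof -
    have dP: "(P has_real_derivative (2 * r + u)) (at r within {c..d})"
      unfolding P_def by (auto intro!: derivative_eq_intros)
    have dD: "(D has_real_derivative D' r) (at r within {c..d})"
      unfolding D_def D'_def using der[OF dg1[OF rng(1)[OF r]]] dersh[OF dg1[OF rng(2)[OF r]]]
      by (rule DERIV_diff)
    have nz: "P r * D r \<noteq> 0" using Ppos[OF r] Dpos[OF r] by simp
    have "w' r = - (inverse (P r * D r) * ((2 * r + u) * D r + D' r * P r) * inverse (P r * D r))"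
      by (simp add: w'_def divide_inverse power2_eq_square algebra_simps)
    then show ?thesis
      using DERIV_inverse'[OF DERIV_mult[OF dP dD] nz] by (simp add: w_def[abs_def] inverse_eq_divide)
  qed
  define \<Phi> where "\<Phi> r = g r - \<beta> * ln r + \<beta> * L r" for r
  have d\<Phi>: "(\<Phi> has_real_derivative (g1 r - \<beta> / r + \<beta> * p r)) (at r within {0<..1})" if "r \<in> {0<..1}" for r
    unfolding \<Phi>_def using that by (auto intro!: derivative_eq_intros dg dL)
  have d\<Theta>: "(\<Theta> has_real_derivative (- D r + \<beta> * s r)) (at r within {c..d})" if r: "r \<in> {c..d}" for r
  proof -
    have "\<Theta> = (\<lambda>r. \<Phi> (r + u) - \<Phi> r)" by (simp add: \<Theta>_def \<Phi>_def fun_eq_iff)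
    moreover have "- D r + \<beta> * s r = (g1 (r+u) - \<beta> / (r+u) + \<beta> * p (r+u)) - (g1 r - \<beta> / r + \<beta> * p r)"
      by (simp add: D_def s_def algebra_simps)
    ultimately show ?thesis
      using DERIV_diff[OF dersh[OF d\<Phi>[OF rng(2)[OF r]]] der[OF d\<Phi>[OF rng(1)[OF r]]]] by simp
  qed
  have dF: "(F has_vector_derivative (E r + R r)) (at r within {c..d})" if r: "r \<in> {c..d}" for r
  proof -
    have "((\<lambda>r. cis (\<Theta> r)) has_vector_derivative ((- D r + \<beta> * s r) *\<^sub>R (\<i> * cis (\<Theta> r)))) (at r within {c..d})"
      unfolding has_vector_derivative_def
      using d\<Theta>[OF r, unfolded has_field_derivative_def]
      by (auto intro!: derivative_eq_intros simp: mult_ac)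
    moreover have "((\<lambda>r. complex_of_real (w r)) has_vector_derivative of_real (w' r)) (at r within {c..d})"
      using dw[OF r] by (rule has_vector_derivative_of_real)
    ultimately have "((\<lambda>r. cis (\<Theta> r) * of_real (w r)) has_vector_derivative
        (cis (\<Theta> r) * of_real (w' r) + ((- D r + \<beta> * s r) *\<^sub>R (\<i> * cis (\<Theta> r))) * of_real (w r))) (at r within {c..d})"
      by (rule has_vector_derivative_mult)
    from has_vector_derivative_mult_right[OF this, of \<i>]
    have "(F has_vector_derivative (\<i> * (cis (\<Theta> r) * of_real (w' r) + ((- D r + \<beta> * s r) *\<^sub>R (\<i> * cis (\<Theta> r))) * of_real (w r)))) (at r within {c..d})"
      unfolding F_def by (simp add: mult.assoc)
    moreover have "D r * w r = 1 / P r" using Dpos[OF r] by (simp add: w_def)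
    then have "complex_of_real (D r) * of_real (w r) = 1 / of_real (P r)"
      by (metis of_real_1 of_real_divide of_real_mult)
    then have "\<i> * (cis (\<Theta> r) * of_real (w' r) + ((- D r + \<beta> * s r) *\<^sub>R (\<i> * cis (\<Theta> r))) * of_real (w r)) = E r + R r"
      by (simp add: E_def R_def scaleR_conv_of_real algebra_simps)
    ultimately show ?thesis by simp
  qed
  have dH: "(H has_real_derivative H' r) (at r within {c..d})" if r: "r \<in> {c..d}" for r
  proof -
    have "((\<lambda>r. r powr (b - 1) / (b - 1)) has_real_derivative r powr (b - 2)) (at r within {c..d})"
      using rng[OF r] params by (auto intro!: derivative_eq_intros)
    then show ?thesis unfolding H_def H'_def mult.assoc
      using dw[OF r] der[OF dV[OF rng(1)[OF r]]] dersh[OF dV[OF rng(2)[OF r]]]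
      by (intro DERIV_add DERIV_cmult) simp_all
  qed
  have R_le: "norm (R r) \<le> H' r" if r: "r \<in> {c..d}" for r
  proof -
    have r0: "0 < r" using rng[OF r] by simp
    have "norm (R r) \<le> \<bar>w' r\<bar> + \<bar>\<beta>\<bar> * (\<bar>s r\<bar> * w r)"
      unfolding R_def norm_mult norm_cis
      by (rule order_trans[OF mult_left_mono[OF norm_triangle_ineq4]])
         (use wpos[OF r] in \<open>auto simp: norm_mult abs_mult\<close>)
    \<comment> \<open>As \<open>g2\<close> increases, \<open>D' \<le> 0\<close>, so only the
      derivative of \<open>P\<close> contributes negatively to \<open>w'\<close>. That part is at
      most \<open>2 * w / r\<close> in size; adding it back twice bounds the absolute value.\<close>
    also have "\<bar>w' r\<bar> \<le> w' r + 4 * (w r / r)"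
    proof -
      have "g2 r \<le> g2 (r + u)" using g2_mono rng[OF r] cd by (auto simp: monotone_on_def)
      then have PD': "P r * D' r \<le> 0" using Ppos[OF r] by (simp add: D'_def mult_nonneg_nonpos)
      define X where "X = (2 * r + u) * D r / (P r * D r)\<^sup>2"
      define Y where "Y = P r * D' r / (P r * D r)\<^sup>2"
      have XY: "w' r = - X - Y" by (simp add: w'_def X_def Y_def add_divide_distrib diff_divide_distrib)
      have "Y \<le> 0" unfolding Y_def using PD' by (simp add: divide_nonpos_nonneg)
      moreover have "X \<ge> 0" unfolding X_def using Dpos[OF r] r0 cd by simp
      moreover have "X \<le> 2 * (w r / r)"
      proof -
        have "X = (2 * r + u) / P r * w r"
          using Dpos[OF r] Ppos[OF r] by (simp add: X_def w_def power2_eq_square)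
        also have "\<dots> \<le> (2 / r) * w r"
        proof (rule mult_right_mono)
          have "(2 * r + u) / P r \<le> (2 * (r + u)) / P r"
            using Ppos[OF r] cd by (intro divide_right_mono) auto
          also have "\<dots> = 2 / r"
            using r0 Ppos[OF r] by (subst frac_eq_eq) (auto simp: P_def algebra_simps)
          finally show "(2 * r + u) / P r \<le> 2 / r" .
        qed (use wpos[OF r] in auto)
        finally show ?thesis by simp
      qed
      ultimately show ?thesis unfolding XY by linarith
    qed
    also have "\<bar>s r\<bar> \<le> \<bar>p (r + u)\<bar> + \<bar>p r\<bar> + 1 / r"
    proof -
      have "1 / (r + u) \<le> 1 / r" "1 / (r + u) \<ge> 0" using r0 cd by (auto simp: field_simps)
      then show ?thesis unfolding s_def by linarith
    qed
    finally have *: "norm (R r) \<le> w' r + (4 + \<bar>\<beta>\<bar>) * (w r / r) + \<bar>\<beta>\<bar> * ((\<bar>p r\<bar> + \<bar>p (r + u)\<bar>) * w r)"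
      using wpos[OF r] by (simp add: algebra_simps mult_left_mono mult_right_mono)
    have "w r / r \<le> C2 / u * (Q * r powr (b - 2))"
    proof -
      have "w r \<le> C2 / u * r powr (b - 1) * Q"
        using w_le[OF r] g1Q[OF rng(1)[OF r]] C2 cd
        by (elim order_trans) (intro mult_left_mono, auto)
      then have "w r / r \<le> C2 / u * r powr (b - 1) * Q / r"
        by (rule divide_right_mono) (use r0 in simp)
      also have "\<dots> = C2 / u * (Q * (r powr (b - 1) / r powr 1))" using r0 by simp
      also have "r powr (b - 1) / r powr 1 = r powr (b - 2)" using r0 powr_diff[of r "b - 1" 1] by simp
      finally show ?thesis .
    qed
    then have 1: "(4 + \<bar>\<beta>\<bar>) * (w r / r) \<le> (4 + \<bar>\<beta>\<bar>) * (C2 / u * (Q * r powr (b - 2)))"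
      by (intro mult_left_mono) auto
    have wd: "w r \<le> C2 / u * d powr (b - 1) * g1 r powr (-\<kappa>)"
    proof -
      have "r powr (b - 1) \<le> d powr (b - 1)" using rng[OF r] params by (intro powr_mono2) auto
      then show ?thesis
        using w_le[OF r] C2 cd by (elim order_trans) (intro mult_right_mono mult_left_mono, auto)
    qed
    \<comment> \<open>\<open>\<bar>p (r + u)\<bar>\<close> has to be paired with the weight at its
      own point; since \<open>g1\<close> decreases, the weight is larger there.\<close>
    have wdu: "w r \<le> C2 / u * d powr (b - 1) * g1 (r + u) powr (-\<kappa>)"
      using g1_powr[OF rng(1)[OF r] rng(2)[OF r]] C2 cd
      by (intro order_trans[OF wd] mult_left_mono) auto
    have "(\<bar>p r\<bar> + \<bar>p (r + u)\<bar>) * w r \<le>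
        \<bar>p r\<bar> * (C2 / u * d powr (b - 1) * g1 r powr (-\<kappa>)) + \<bar>p (r + u)\<bar> * (C2 / u * d powr (b - 1) * g1 (r + u) powr (-\<kappa>))"
      unfolding distrib_right using wd wdu by (intro add_mono mult_left_mono) auto
    then have "\<bar>\<beta>\<bar> * ((\<bar>p r\<bar> + \<bar>p (r + u)\<bar>) * w r) \<le> \<bar>\<beta>\<bar> * (
        \<bar>p r\<bar> * (C2 / u * d powr (b - 1) * g1 r powr (-\<kappa>)) + \<bar>p (r + u)\<bar> * (C2 / u * d powr (b - 1) * g1 (r + u) powr (-\<kappa>)))"
      by (intro mult_left_mono) auto
    with * 1 show ?thesis unfolding H'_def by (simp add: algebra_simps add_divide_distrib)
  qed
  have intF: "((\<lambda>r. E r + R r) has_integral (F d - F c)) {c..d}"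
    using dF cd by (intro fundamental_theorem_of_calculus) auto
  have intH: "(H' has_integral (H d - H c)) {c..d}"
    using dH cd by (intro fundamental_theorem_of_calculus) (auto simp: has_real_derivative_iff_has_vector_derivative)
  have "continuous_on {c..d} \<Theta>"
    using d\<Theta> by (intro DERIV_continuous_on)
  then have "continuous_on {c..d} E"
    unfolding E_def P_def using cd by (intro continuous_intros) (auto simp flip: of_real_add)
  then have intE: "E integrable_on {c..d}" by (rule integrable_continuous_real)
  \<comment> \<open>\<open>R\<close> inherits integrability from the exact derivative
    \<open>E + R\<close> and the continuous \<open>E\<close>.\<close>
  have intR: "R integrable_on {c..d}"
    using integrable_diff[OF has_integral_integrable[OF intF] intE] by simp
  have "integral {c..d} E = (F d - F c) - integral {c..d} R"
    using integral_unique[OF intF] integral_add[OF intE intR] by (simp add: eq_diff_eq)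
  also have "norm \<dots> \<le> norm (F d) + norm (F c) + norm (integral {c..d} R)"
    by (smt (verit) norm_triangle_ineq4)
  also have "norm (integral {c..d} R) \<le> H d - H c"
    using integral_norm_bound_integral[OF intR has_integral_integrable[OF intH] R_le] integral_unique[OF intH]
    by simp
  also have "norm (F d) = w d" using wpos[of d] cd by (simp add: F_def norm_mult)
  also have "norm (F c) = w c" using wpos[of c] cd by (simp add: F_def norm_mult)
  finally have "norm (integral {c..d} E) \<le> w d + w c + (H d - H c)" by simp
  \<comment> \<open>The boundary term \<open>w c\<close> cancels against the \<open>w\<close> inside
    \<open>H c\<close>, whose power term has a favourable sign, so nothing singular as
    \<open>c\<close> tends to \<open>0\<close> survives.\<close>
  also have "\<dots> \<le> C2 / u * d powr (b - 1) * (2 * Q) + C2 / u * ((4 + \<bar>\<beta>\<bar>) * Q * (d powr (b - 1) / (b - 1))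
                    + \<bar>\<beta>\<bar> * d powr (b - 1) * (2 * M))"
  proof -
    have dd: "d \<in> {c..d}" using cd by simp
    define T where "T r = C2 / u * ((4 + \<bar>\<beta>\<bar>) * Q * (r powr (b - 1) / (b - 1)))" for r
    define K where "K = C2 / u * (\<bar>\<beta>\<bar> * d powr (b - 1))"
    define Z where "Z = C2 / u * d powr (b - 1) * Q"
    have H: "H r = w r + T r + K * (V r + V (r + u))" for r
      unfolding H_def T_def K_def by (simp only: distrib_left mult.assoc add.assoc)
    have "w d \<le> Z"
      unfolding Z_def using w_le[OF dd] g1Q[OF rng(1)[OF dd]] C2 cd
      by (elim order_trans) (intro mult_left_mono, auto)
    moreover have "V d + V (d + u) - (V c + V (c + u)) \<le> 2 * M"
      using V_bounds[of d] V_bounds[of c] V_bounds[of "d+u"] V_bounds[of "c+u"] params cd by auto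
    then have "K * (V d + V (d + u) - (V c + V (c + u))) \<le> K * (2 * M)"
      by (rule mult_left_mono) (use C2 cd in \<open>auto simp: K_def\<close>)
    then have "K * (V d + V (d + u)) - K * (V c + V (c + u)) \<le> K * (2 * M)"
      by (simp only: right_diff_distrib)
    moreover have "T c \<ge> 0"
      using C2 cd Q params by (simp add: T_def)
    moreover have "C2 / u * d powr (b - 1) * (2 * Q) + C2 / u * ((4 + \<bar>\<beta>\<bar>) * Q * (d powr (b - 1) / (b - 1))
                    + \<bar>\<beta>\<bar> * d powr (b - 1) * (2 * M)) = 2 * Z + T d + K * (2 * M)"
      unfolding Z_def T_def K_def by (simp only: distrib_left mult_ac add.assoc)
    ultimately show ?thesis unfolding H by linarith
  qed
  also have "\<dots> = C2 * (2 * Q + (4 + \<bar>\<beta>\<bar>) * Q / (b - 1) + \<bar>\<beta>\<bar> * (2 * M)) * (d powr (b - 1) / u)"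
    by (simp add: algebra_simps add_divide_distrib)
  also have "\<dots> \<le> C2 * ((3 * Q + 4 * Q / (b - 1) + 2 * M) * (1 + \<bar>\<beta>\<bar>)) * (d powr (b - 1) / u)"
  proof -
    have M: "M \<ge> 0" using V_bounds[of 1] by simp
    have "(3 * Q + 4 * Q / (b - 1) + 2 * M) * (1 + \<bar>\<beta>\<bar>) - (2 * Q + (4 + \<bar>\<beta>\<bar>) * Q / (b - 1) + \<bar>\<beta>\<bar> * (2 * M))
        = Q + 2 * M + 3 * Q * \<bar>\<beta>\<bar> + 3 * \<bar>\<beta>\<bar> * (Q / (b - 1))"
      by (simp add: algebra_simps add_divide_distrib)
    also have "\<dots> \<ge> 0" using Q M params by auto
    finally have "2 * Q + (4 + \<bar>\<beta>\<bar>) * Q / (b - 1) + \<bar>\<beta>\<bar> * (2 * M) \<le> (3 * Q + 4 * Q / (b - 1) + 2 * M) * (1 + \<bar>\<beta>\<bar>)" by simp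
    then show ?thesis using C2 cd by (intro mult_right_mono mult_left_mono) auto
  qed
  finally show ?thesis
    by (simp add: E_def[abs_def] \<Theta>_def P_def C2_def Q_def mult.assoc)
qed

text \<open>The integrand is dominated by \<open>1 / r ^ 2\<close>, whose integral beyond
  \<open>c\<close> is at most \<open>1 / c\<close>.\<close>

lemma correlation_integral_trivial:
  fixes \<Theta> :: "real \<Rightarrow> real"
  assumes "continuous_on {c..d} \<Theta>" "0 < c" "c \<le> d" "0 \<le> u"
  shows "(\<lambda>r. cis (\<Theta> r) / of_real (r * (r + u))) integrable_on {c..d}"
    and "norm (integral {c..d} (\<lambda>r. cis (\<Theta> r) / of_real (r * (r + u)))) \<le> 1 / c"
proof -
  have "continuous_on {c..d} (\<lambda>r. cis (\<Theta> r) / of_real (r * (r + u)))"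
    using assms by (intro continuous_intros) (auto simp flip: of_real_add)
  then show int: "(\<lambda>r. cis (\<Theta> r) / of_real (r * (r + u))) integrable_on {c..d}"
    by (rule integrable_continuous_real)
  have "((\<lambda>r. - 1 / r) has_real_derivative 1 / r\<^sup>2) (at r within {c..d})" if "r \<in> {c..d}" for r
    using that assms by (auto intro!: derivative_eq_intros simp: power2_eq_square)
  then have I: "((\<lambda>r. 1 / r\<^sup>2) has_integral (- 1 / d - (- 1 / c))) {c..d}"
    using assms by (intro fundamental_theorem_of_calculus) (auto simp: has_real_derivative_iff_has_vector_derivative)
  have "norm (integral {c..d} (\<lambda>r. cis (\<Theta> r) / of_real (r * (r + u)))) \<le> integral {c..d} (\<lambda>r. 1 / r\<^sup>2)"
  proof (rule integral_norm_bound_integral[OF int has_integral_integrable[OF I]])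
    fix r assume r: "r \<in> {c..d}"
    have "r\<^sup>2 \<le> r * (r + u)" using r assms by (simp add: power2_eq_square)
    moreover have "r\<^sup>2 > 0" using r assms by simp
    ultimately have "1 / (r * (r + u)) \<le> 1 / r\<^sup>2" by (intro frac_le) auto
    then show "norm (cis (\<Theta> r) / of_real (r * (r + u))) \<le> 1 / r\<^sup>2"
      using r assms by (simp add: norm_divide norm_mult flip: of_real_add)
  qed
  also have "\<dots> \<le> 1 / c" using integral_unique[OF I] assms by simp
  finally show "norm (integral {c..d} (\<lambda>r. cis (\<Theta> r) / of_real (r * (r + u)))) \<le> 1 / c" .
qed

text \<open>Splitting at \<open>u powr (1 / b)\<close> balances the oscillatory bound
  \<open>d powr (b - 1) / u\<close>, which grows with \<open>d\<close>, against the trivial bound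
  \<open>1 / c\<close> above the split; both equal \<open>u powr (- (1 / b))\<close> there.\<close>

lemma correlation_integral_bound:
  fixes \<Theta> :: "real \<Rightarrow> real"
  assumes near: "\<And>d. c \<le> d \<Longrightarrow> d \<le> t1 \<Longrightarrow> d + u \<le> 1 \<Longrightarrow>
       norm (integral {c..d} (\<lambda>r. cis (\<Theta> r) / of_real (r * (r + u)))) \<le> Z * (d powr (b - 1) / u)"
    and cont: "continuous_on {c..d} \<Theta>"
    and params: "0 < t1" "b > 1" "Z \<ge> 0" and cd: "0 < c" "c \<le> d" "0 < u" "d + u \<le> 1"
  shows "norm (integral {c..d} (\<lambda>r. cis (\<Theta> r) / of_real (r * (r + u)))) \<le> (Z + 1 + 1 / t1) * u powr (- (1 / b))"
proof -
  define E where "E r = cis (\<Theta> r) / complex_of_real (r * (r + u))" for r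
  define \<rho> where "\<rho> = min t1 (u powr (1 / b))"
  define U where "U = u powr (- (1 / b))"
  have u1: "u \<le> 1" using cd by simp
  have \<rho>: "0 < \<rho>" "\<rho> \<le> t1" using params cd by (auto simp: \<rho>_def)
  have U: "U \<ge> 1" using u1 cd params powr_mono2'[of "- (1 / b)" u 1] by (simp add: U_def)
  have U': "U > 0" using U by simp
  \<comment> \<open>When the split point is capped at \<open>t1\<close>, the summand
    \<open>1 / t1\<close> of the constant pays for it, because \<open>U \<ge> 1\<close>.\<close>
  have inv\<rho>: "1 / \<rho> \<le> (1 + 1 / t1) * U"
  proof (cases "t1 \<le> u powr (1 / b)")
    case True
    then have "1 / \<rho> = 1 / t1" by (simp add: \<rho>_def)
    also have "\<dots> \<le> 1 / t1 * U" using mult_left_mono[OF U, of "1 / t1"] params by simp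
    also have "\<dots> \<le> (1 + 1 / t1) * U" using U by (intro mult_right_mono) auto
    finally show ?thesis .
  next
    case False
    then have "1 / \<rho> = U" using cd by (simp add: \<rho>_def U_def powr_minus field_simps)
    also have "\<dots> \<le> (1 + 1 / t1) * U" using U params by (simp add: distrib_right)
    finally show ?thesis .
  qed
  have low: "norm (integral {c..d'} E) \<le> Z * U" if d': "c \<le> d'" "d' \<le> \<rho>" "d' + u \<le> 1" for d'
  proof -
    have "norm (integral {c..d'} E) \<le> Z * (d' powr (b - 1) / u)"
      unfolding E_def using near[of d'] d' \<rho> by simp
    also have "\<dots> \<le> Z * ((u powr (1 / b)) powr (b - 1) / u)"
      using d' cd params by (intro mult_left_mono divide_right_mono powr_mono2) (auto simp: \<rho>_def)
    also have "(u powr (1 / b)) powr (b - 1) / u = u powr (1 / b * (b - 1) - 1)"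
      unfolding powr_powr powr_diff[of u _ 1] using cd by (simp only: powr_one less_imp_le)
    also have "1 / b * (b - 1) - 1 = - (1 / b)" using params by (simp add: field_simps)
    finally show ?thesis unfolding U_def .
  qed
  have high: "norm (integral {c'..d} E) \<le> (1 + 1 / t1) * U" if c': "c \<le> c'" "\<rho> \<le> c'" "c' \<le> d" for c'
  proof -
    have "norm (integral {c'..d} E) \<le> 1 / c'"
      unfolding E_def using c' cd
      by (intro correlation_integral_trivial continuous_on_subset[OF cont]) auto
    also have "\<dots> \<le> 1 / \<rho>" using c' \<rho> by (intro frac_le) auto
    finally show ?thesis using inv\<rho> by linarith
  qed
  have pos: "Z * U \<ge> 0" "(1 + 1 / t1) * U \<ge> 0" using params U by auto
  consider "d \<le> \<rho>" | "\<rho> \<le> c" | "c < \<rho>" "\<rho> < d" by linarith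
  then have "norm (integral {c..d} E) \<le> Z * U + (1 + 1 / t1) * U"
  proof cases
    case 1
    then show ?thesis using low[of d] cd pos by simp
  next
    case 2
    then show ?thesis using high[of c] cd pos by simp
  next
    case 3
    have "E integrable_on {c..d}" unfolding E_def
      using cd by (intro correlation_integral_trivial cont) auto
    then have "integral {c..d} E = integral {c..\<rho>} E + integral {\<rho>..d} E"
      using 3 by (simp add: Henstock_Kurzweil_Integration.integral_combine)
    moreover have "norm (integral {c..\<rho>} E) \<le> Z * U" using low[of \<rho>] 3 cd by simp
    moreover have "norm (integral {\<rho>..d} E) \<le> (1 + 1 / t1) * U" using high[of \<rho>] 3 by simp
    ultimately show ?thesis using norm_triangle_ineq by (metis add_mono order_trans)
  qed
  also have "\<dots> = (Z + 1 + 1 / t1) * U" by (simp add: algebra_simps)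
  finally show ?thesis unfolding E_def U_def .
qed

section \<open>Phase form of the kernel and its correlations\<close>

lemma K_kernel_eq:
  assumes "\<forall>t\<in>{0<..1}. \<psi> t > 0" "\<epsilon> > 0"
  shows "K_kernel \<gamma> \<psi> \<epsilon> \<beta> x =
    (if x \<in> {\<epsilon>..1} then cis (\<gamma> x - \<beta> * ln x + \<beta> * ln (\<psi> x)) / of_real x else 0)"
proof (cases "x \<in> {\<epsilon>..1}")
  case True
  then have x: "x > 0" "\<psi> x > 0" using assms by auto
  \<comment> \<open>A purely imaginary power of a positive real has modulus one, so apart from the
    factor \<open>x\<close> both complex powers only move the phase.\<close>
  have "complex_of_real x powr (1 + \<i> * of_real \<beta>) = of_real x * cis (\<beta> * ln x)"
  proof -
    have "complex_of_real x powr (1 + \<i> * of_real \<beta>) = of_real x * of_real x powr (\<i> * of_real \<beta>)"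
      using x by (simp add: powr_add)
    also have "complex_of_real x powr (\<i> * of_real \<beta>) = cis (\<beta> * ln x)"
      using x by (simp add: powr_def Ln_of_real cis_conv_exp mult_ac)
    finally show ?thesis .
  qed
  moreover have "complex_of_real (\<psi> x) powr (- \<i> * of_real \<beta>) = cis (- (\<beta> * ln (\<psi> x)))"
    using x by (simp add: powr_def Ln_of_real cis_conv_exp mult_ac)
  moreover have "exp (\<i> * complex_of_real (\<gamma> x)) = cis (\<gamma> x)" by (simp add: cis_conv_exp)
  ultimately have "K_kernel \<gamma> \<psi> \<epsilon> \<beta> x =
      cis (\<gamma> x) / (of_real x * cis (\<beta> * ln x) * cis (- (\<beta> * ln (\<psi> x))))"
    using True by (simp only: K_kernel_def mult.assoc) simp
  also have "cis (\<gamma> x) / (of_real x * cis (\<beta> * ln x) * cis (- (\<beta> * ln (\<psi> x))))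
      = cis (\<gamma> x) / (cis (\<beta> * ln x) * cis (- (\<beta> * ln (\<psi> x)))) / of_real x"
    by (simp add: mult_ac)
  also have "\<dots> = cis (\<gamma> x - \<beta> * ln x + \<beta> * ln (\<psi> x)) / of_real x"
    by (simp add: cis_mult cis_divide algebra_simps)
  finally show ?thesis using True by simp
qed (auto simp: K_kernel_def)

text \<open>Both \<open>r\<close> and \<open>r + u\<close> must lie in
  \<open>{\<epsilon>..1}\<close>, which with the cut at \<open>c\<close> leaves a compact, possibly
  empty, interval away from \<open>0\<close>. The phase is continuous there, so the Lebesgue and the
  gauge integral agree.\<close>

lemma correlation_K_kernel:
  fixes \<gamma> \<psi> :: "real \<Rightarrow> real"
  defines "\<Phi> \<equiv> \<lambda>\<beta> x. \<gamma> x - \<beta> * ln x + \<beta> * ln (\<psi> x)"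
  assumes pos: "\<forall>t\<in>{0<..1}. \<psi> t > 0" and "\<epsilon> > 0" "u \<ge> 0" "c \<ge> 0"
    and cont: "continuous_on {0<..1} \<gamma>" "continuous_on {0<..1} \<psi>"
  shows "(LINT r|lborel. indicator {c<..} r *\<^sub>R (K_kernel \<gamma> \<psi> \<epsilon> \<beta> (r + u) * cnj (K_kernel \<gamma> \<psi> \<epsilon> \<beta> r)))
    = integral {max c \<epsilon>..1 - u} (\<lambda>r. cis (\<Phi> \<beta> (r + u) - \<Phi> \<beta> r) / of_real (r * (r + u)))"
proof -
  define E where "E r = cis (\<Phi> \<beta> (r + u) - \<Phi> \<beta> r) / complex_of_real (r * (r + u))" for r
  have c\<Phi>: "continuous_on {0<..1} (\<Phi> \<beta>)"
    unfolding \<Phi>_def using pos by (intro continuous_intros cont) force+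
  have E: "K_kernel \<gamma> \<psi> \<epsilon> \<beta> (r + u) * cnj (K_kernel \<gamma> \<psi> \<epsilon> \<beta> r) = E r" if "r \<in> {\<epsilon>..1-u}" for r
  proof -
    have "K_kernel \<gamma> \<psi> \<epsilon> \<beta> (r + u) = cis (\<Phi> \<beta> (r + u)) / of_real (r + u)"
      "K_kernel \<gamma> \<psi> \<epsilon> \<beta> r = cis (\<Phi> \<beta> r) / of_real r"
      using that assms(3,4) by (simp_all add: K_kernel_eq[OF pos \<open>\<epsilon> > 0\<close>] \<Phi>_def)
    then show ?thesis
      by (simp add: E_def cis_cnj cis_mult mult.commute flip: of_real_add)
  qed
  have Z: "K_kernel \<gamma> \<psi> \<epsilon> \<beta> (r + u) * cnj (K_kernel \<gamma> \<psi> \<epsilon> \<beta> r) = 0" if "r \<notin> {\<epsilon>..1-u}" for r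
    using that assms by (auto simp: K_kernel_def)
  have cE: "continuous_on {max c \<epsilon>..1 - u} E"
    unfolding E_def using assms
    by (intro continuous_intros continuous_on_compose2[OF c\<Phi>]) (auto simp flip: of_real_add)
  have "(LINT r|lborel. indicator {c<..} r *\<^sub>R (K_kernel \<gamma> \<psi> \<epsilon> \<beta> (r + u) * cnj (K_kernel \<gamma> \<psi> \<epsilon> \<beta> r)))
     = (LINT r|lborel. indicator {c<..} r *\<^sub>R (indicator {max c \<epsilon>..1 - u} r *\<^sub>R E r))"
    by (intro Bochner_Integration.integral_cong refl) (auto simp: E Z indicator_def)
  also have "\<dots> = (LINT r:{max c \<epsilon>..1 - u}|lborel. E r)"
    unfolding set_lebesgue_integral_def
  proof (rule integral_cong_AE)
    have [measurable]: "(\<lambda>r. indicator {max c \<epsilon>..1 - u} r *\<^sub>R E r) \<in> borel_measurable lborel"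
      using borel_measurable_continuous_on_indicator[OF _ cE] by simp
    show "(\<lambda>r. indicator {max c \<epsilon>..1 - u} r *\<^sub>R E r) \<in> borel_measurable lborel" by measurable
    show "(\<lambda>r. indicator {c<..} r *\<^sub>R (indicator {max c \<epsilon>..1 - u} r *\<^sub>R E r)) \<in> borel_measurable lborel" by measurable
    show "AE r in lborel. indicator {c<..} r *\<^sub>R (indicator {max c \<epsilon>..1 - u} r *\<^sub>R E r) = indicator {max c \<epsilon>..1 - u} r *\<^sub>R E r"
      using AE_lborel_singleton[of c] by eventually_elim (auto simp: indicator_def)
  qed
  also have "\<dots> = integral {max c \<epsilon>..1 - u} E"
    using cE by (intro set_borel_integral_eq_integral borel_integrable_atLeastAtMost')
  finally show ?thesis unfolding E_def .
qed

lemma K_kernel_measurable: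
  fixes \<gamma> \<psi> :: "real \<Rightarrow> real"
  assumes pos: "\<forall>t\<in>{0<..1}. \<psi> t > 0" and "\<epsilon> > 0"
    and cont: "continuous_on {0<..1} \<gamma>" "continuous_on {0<..1} \<psi>"
  shows "K_kernel \<gamma> \<psi> \<epsilon> \<beta> \<in> borel_measurable borel"
proof -
  have sub: "{\<epsilon>..1} \<subseteq> {0<..1}" using assms by auto
  have "continuous_on {\<epsilon>..1} (\<lambda>x. cis (\<gamma> x - \<beta> * ln x + \<beta> * ln (\<psi> x)) / complex_of_real x)"
    using sub pos by (intro continuous_intros cont[THEN continuous_on_subset] sub) (auto simp: subset_eq, force+)
  then show ?thesis
    unfolding K_kernel_eq[OF pos \<open>\<epsilon> > 0\<close>, abs_def]
    by (intro borel_measurable_continuous_on_if) auto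
qed

lemma K_kernel_norm_le:
  assumes "\<forall>t\<in>{0<..1}. \<psi> t > 0" "\<epsilon> > 0"
  shows "norm (K_kernel \<gamma> \<psi> \<epsilon> \<beta> x) \<le> 1 / \<epsilon>"
  using assms(2) by (auto simp: K_kernel_eq[OF assms] norm_divide intro!: frac_le)

subsection \<open>The growth of the phase\<close>

text \<open>With \<open>(1 + e) powr a = A\<close>, the decay says that
  \<open>r powr a * g1 r\<close> does not drop when a small \<open>r\<close> is divided by
  \<open>1 + e\<close>. Monotonicity bounds it below on \<open>{t1..1}\<close>, hence everywhere.
  That \<open>a > 1\<close> amounts to \<open>A > 1 + e\<close>.\<close>

lemma power_growth_of_geometric_decay:
  fixes g1 :: "real \<Rightarrow> real"
  assumes pos: "\<And>t. t \<in> {0<..1} \<Longrightarrow> g1 t > 0"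
    and anti: "antimono_on {0<..1} g1"
    and t0: "t0 > 0" and e: "e > 0" "A > 1 + e"
    and decay: "\<And>t. 0 < t \<Longrightarrow> t < t0 \<Longrightarrow> (1 + e) * t \<le> 1 \<Longrightarrow> g1 t \<ge> A * g1 ((1 + e) * t)"
  shows "\<exists>c a. c > 0 \<and> a > 1 \<and> (\<forall>r\<in>{0<..1}. g1 r \<ge> c * r powr (-a))"
proof -
  define a where "a = ln A / ln (1 + e)"
  define t1 where "t1 = min (t0 / 2) (1 / (1 + e))"
  define c where "c = t1 powr a * g1 1"
  have lne: "ln (1 + e) > 0" "ln A > ln (1 + e)" using e by auto
  then have a: "a > 1" by (simp add: a_def)
  have Aa: "(1 + e) powr a = A" using e lne by (simp add: a_def powr_def)
  have t1: "0 < t1" "t1 < t0" "(1 + e) * t1 \<le> 1" "t1 \<le> 1"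
  proof -
    have "(1 + e) * t1 \<le> (1 + e) * (1 / (1 + e))"
      using e by (intro mult_left_mono) (auto simp: t1_def)
    then show "(1 + e) * t1 \<le> 1" using e by simp
    show "t1 \<le> 1" using e by (auto simp: t1_def min_le_iff_disj)
  qed (use e t0 in \<open>auto simp: t1_def min_less_iff_disj\<close>)
  have c: "c > 0" using t1 pos[of 1] by (simp add: c_def)
  \<comment> \<open>Induction on a bound \<open>n\<close> for the number of dilations by
    \<open>1 + e\<close> that carry \<open>r\<close> up to \<open>t1\<close>.\<close>
  have step: "t1 / (1 + e) ^ n \<le> r \<Longrightarrow> r \<in> {0<..1} \<Longrightarrow> r powr a * g1 r \<ge> c" for n r
  proof (induction n arbitrary: r)
    case 0
    have "g1 1 \<le> g1 r" using anti 0 by (auto simp: monotone_on_def)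
    then show ?case unfolding c_def using 0 t1 a pos[of 1]
      by (intro mult_mono powr_mono2) auto
  next
    case (Suc n)
    show ?case
    proof (cases "t1 \<le> r")
      case True
      have "g1 1 \<le> g1 r" using anti Suc by (auto simp: monotone_on_def)
      then show ?thesis unfolding c_def using Suc True t1 a pos[of 1]
        by (intro mult_mono powr_mono2) auto
    next
      case False
      have r: "0 < r" "r < t0" using False t1 Suc by auto
      have "(1 + e) * r \<le> (1 + e) * t1" using False e by (intro mult_left_mono) auto
      then have r1: "(1 + e) * r \<le> 1" using t1 by linarith
      have "t1 / (1 + e) ^ n \<le> (1 + e) * r"
        using mult_left_mono[OF Suc.prems(1), of "1 + e"] e by simp
      then have "c \<le> ((1 + e) * r) powr a * g1 ((1 + e) * r)"
        using r r1 e by (intro Suc.IH) auto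
      also have "\<dots> = r powr a * (A * g1 ((1 + e) * r))"
        using Aa r e by (simp add: powr_mult)
      also have "\<dots> \<le> r powr a * g1 r"
        using decay[OF r r1] by (intro mult_left_mono) auto
      finally show ?thesis .
    qed
  qed
  have "g1 r \<ge> c * r powr (-a)" if r: "r \<in> {0<..1}" for r
  proof -
    obtain n where "t1 / r < (1 + e) ^ n" using real_arch_pow[of "1 + e" "t1 / r"] e by auto
    then have "t1 / (1 + e) ^ n \<le> r" using r e by (simp add: field_simps)
    from step[OF this r] show ?thesis
      using r by (simp add: powr_minus field_simps)
  qed
  with c a show ?thesis by blast
qed

text \<open>Convexity: as \<open>g2\<close> increases, the mean value points of the two consecutive
  steps have ordered slopes, so the average decrease of \<open>g1\<close> is larger over the shorter
  step.\<close>

lemma convex_increment_ratio: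
  fixes g1 g2 :: "real \<Rightarrow> real"
  assumes d: "\<And>t. t \<in> {0<..1} \<Longrightarrow> (g1 has_real_derivative g2 t) (at t within {0<..1})"
    and mono: "mono_on {0<..1} g2"
    and "0 < r" "0 < u" "u \<le> v" "r + v \<le> 1"
  shows "u * (g1 r - g1 (r + v)) \<le> v * (g1 r - g1 (r + u))"
proof (cases "u = v")
  case False
  have sub: "{x..y} \<subseteq> {0<..1}" if "r \<le> x" "y \<le> r + v" for x y using that assms by auto
  have mvt: "\<exists>z\<in>{x<..<y}. g1 y - g1 x = (y - x) * g2 z" if "r \<le> x" "x < y" "y \<le> r + v" for x y
  proof -
    have "\<exists>z\<in>{x<..<y}. g1 y - g1 x = (\<lambda>h. h * g2 z) (y - x)"
    proof (rule mvt_simple[OF that(2)])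
      fix z assume "x \<le> z" "z \<le> y"
      then have "(g1 has_real_derivative g2 z) (at z within {x..y})"
        using sub[OF that(1,3)] by (intro has_field_derivative_subset[OF d]) auto
      then show "(g1 has_derivative (\<lambda>h. h * g2 z)) (at z within {x..y})"
        by (simp add: has_field_derivative_def mult_commute_abs)
    qed
    then show ?thesis by simp
  qed
  obtain z1 where z1: "z1 \<in> {r<..<r+u}" "g1 (r+u) - g1 r = u * g2 z1"
    using mvt[of r "r+u"] assms by auto
  obtain z2 where z2: "z2 \<in> {r+u<..<r+v}" "g1 (r+v) - g1 (r+u) = (v-u) * g2 z2"
    using mvt[of "r+u" "r+v"] assms False by auto
  have "g2 z1 \<le> g2 z2"
    using mono z1 z2 assms by (auto simp: monotone_on_def)
  then have "u * (v - u) * g2 z1 \<le> u * (v - u) * g2 z2"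
    using assms by (intro mult_left_mono) auto
  moreover have "v * (g1 r - g1 (r + u)) - u * (g1 r - g1 (r + v))
      = u * (g1 (r+v) - g1 (r+u)) - (v - u) * (g1 (r+u) - g1 r)"
    by (simp add: algebra_simps)
  ultimately show ?thesis unfolding z1(2) z2(2) by (simp add: algebra_simps)
qed simp

text \<open>One dilation by \<open>1 + e\<close> removes at least the proportion
  \<open>1 - 1 / A\<close> of \<open>g1 r\<close>. A longer step keeps that loss by monotonicity; a
  shorter one has at least the share \<open>u / (e * r)\<close> of it by convexity. The factor
  \<open>min 1 (1 / e)\<close> serves both cases.\<close>

lemma increment_lower_bound:
  fixes g1 g2 :: "real \<Rightarrow> real"
  assumes d: "\<And>t. t \<in> {0<..1} \<Longrightarrow> (g1 has_real_derivative g2 t) (at t within {0<..1})"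
    and mono: "mono_on {0<..1} g2"
    and pos: "\<And>t. t \<in> {0<..1} \<Longrightarrow> g1 t > 0"
    and anti: "antimono_on {0<..1} g1"
    and e: "e > 0" "A > 1 + e"
    and r: "0 < r" "(1 + e) * r \<le> 1" and decay: "g1 r \<ge> A * g1 ((1 + e) * r)"
    and u: "0 < u" "r + u \<le> 1"
  shows "(1 - 1 / A) * min 1 (1 / e) * u * g1 r \<le> (r + u) * (g1 r - g1 (r + u))"
proof -
  have A: "A > 0" "1 - 1 / A > 0" using e by (auto simp: field_simps)
  have er: "r + e * r \<le> 1" using r by (simp add: algebra_simps)
  have gr: "g1 r > 0" using pos r u by auto
  have drop: "(1 - 1 / A) * g1 r \<le> g1 r - g1 (r + e * r)"
    using decay A by (simp add: field_simps)
  show ?thesis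
  proof (cases "e * r \<le> u")
    case True
    have "0 < e * r" using e r by simp
    then have "g1 (r + u) \<le> g1 (r + e * r)"
      using anti True r u er by (auto simp: monotone_on_def)
    with drop have *: "(1 - 1 / A) * g1 r \<le> g1 r - g1 (r + u)" by linarith
    have "(1 - 1 / A) * min 1 (1 / e) * u * g1 r = min 1 (1 / e) * (u * ((1 - 1 / A) * g1 r))" by simp
    also have "\<dots> \<le> 1 * (u * ((1 - 1 / A) * g1 r))"
      using u A gr by (intro mult_right_mono) auto
    also have "\<dots> \<le> (r + u) * (g1 r - g1 (r + u))"
      unfolding mult_1 using * u r A gr by (intro mult_mono) auto
    finally show ?thesis .
  next
    case False
    then have "u * (g1 r - g1 (r + e * r)) \<le> e * r * (g1 r - g1 (r + u))"
      using convex_increment_ratio[OF d mono, of r u "e * r"] r u er by simp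
    moreover have "u * ((1 - 1 / A) * g1 r) \<le> u * (g1 r - g1 (r + e * r))"
      using drop u by (intro mult_left_mono) auto
    ultimately have "u * ((1 - 1 / A) * g1 r) \<le> e * r * (g1 r - g1 (r + u))" by linarith
    then have *: "(1 / e) * (u * ((1 - 1 / A) * g1 r)) \<le> r * (g1 r - g1 (r + u))"
      using e by (simp add: field_simps)
    have "(1 - 1 / A) * min 1 (1 / e) * u * g1 r = min 1 (1 / e) * (u * ((1 - 1 / A) * g1 r))" by simp
    also have "\<dots> \<le> (1 / e) * (u * ((1 - 1 / A) * g1 r))"
      using u A gr by (intro mult_right_mono) auto
    also note *
    also have "r * (g1 r - g1 (r + u)) \<le> (r + u) * (g1 r - g1 (r + u))"
      using anti r u by (intro mult_right_mono) (auto simp: monotone_on_def)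
    finally show ?thesis .
  qed
qed

text \<open>By (a.2) and the polynomial bound on \<open>g2\<close>, the density is at most a constant multiple of the
  derivative of \<open>(- g2) powr (-\<mu>)\<close> near \<open>0\<close>, where \<open>\<mu> = \<kappa> / (2 * lam)\<close>.\<close>

lemma bounded_weighted_primitive:
  fixes g1 g2 g3 p :: "real \<Rightarrow> real"
  assumes dg2: "\<And>t. t \<in> {0<..1} \<Longrightarrow> (g2 has_real_derivative g3 t) (at t within {0<..1})"
    and g2_mono: "mono_on {0<..1} g2"
    and g1_pos: "\<And>t. t \<in> {0<..1} \<Longrightarrow> g1 t > 0"
    and cont_p: "continuous_on {0<..1} p" and cont_g1: "continuous_on {0<..1} g1"
    and t1: "0 < t1" "t1 < 1" "g2 t1 < 0"
    and p_le: "\<And>t. 0 < t \<Longrightarrow> t \<le> t1 \<Longrightarrow> \<bar>p t\<bar> \<le> 1/2 * \<bar>g3 t / g2 t\<bar>"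
    and g2_le: "\<And>t. 0 < t \<Longrightarrow> t \<le> t1 \<Longrightarrow> \<bar>g2 t\<bar> \<le> C * g1 t powr (2 * lam)"
    and params: "C > 0" "lam > 0" "\<kappa> > 0"
  shows "\<exists>V M. (\<forall>t\<in>{0<..1}. (V has_real_derivative \<bar>p t\<bar> * g1 t powr (-\<kappa>)) (at t within {0<..1}))
           \<and> (\<forall>t\<in>{0<..1}. - M \<le> V t \<and> V t \<le> 0)"
proof -
  define v where "v t = \<bar>p t\<bar> * g1 t powr (-\<kappa>)" for t
  define \<mu> where "\<mu> = \<kappa> / (2 * lam)"
  have \<mu>: "\<mu> > 0" "2 * lam * \<mu> = \<kappa>" using params by (auto simp: \<mu>_def)
  \<comment> \<open>Integrating down from \<open>1\<close> makes \<open>V\<close> nonpositive, and a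
    lower bound for \<open>V\<close> is then a bound on the mass of \<open>v\<close> near
    \<open>0\<close>.\<close>
  define V where "V t = - integral {t..1} v" for t
  define M where "M = C powr \<mu> / (2 * \<mu>) * (- g2 t1) powr (-\<mu>) + integral {t1..1} v"
  have cont_v: "continuous_on {0<..1} v"
    unfolding v_def using g1_pos
    by (intro continuous_intros cont_p cont_g1) (use g1_pos in force)+
  have int_v: "v integrable_on {a..b}" if "0 < a" "b \<le> 1" for a b
    using that by (intro integrable_continuous_real continuous_on_subset[OF cont_v]) auto
  have v_nonneg: "v t \<ge> 0" for t by (simp add: v_def)
  have dV: "(V has_real_derivative v t) (at t within {0<..1})" if t: "t \<in> {0<..1}" for t
  proof -
    \<comment> \<open>Starting at \<open>t/2\<close> keeps \<open>t\<close> off the left endpoint,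
      so that the derivative within \<open>{t/2..1}\<close> is the one within
      \<open>{0<..1}\<close>.\<close>
    have "((\<lambda>x. integral {t/2..x} v) has_real_derivative v t) (at t within {t/2..1})"
      using t by (intro integral_has_real_derivative continuous_on_subset[OF cont_v]) auto
    then have "((\<lambda>x. integral {t/2..x} v - integral {t/2..1} v) has_real_derivative v t) (at t within {t/2..1})"
      by (auto intro!: derivative_eq_intros)
    then have "(V has_real_derivative v t) (at t within {t/2..1})"
    proof (rule has_field_derivative_transform_within[OF _ zero_less_one])
      fix x assume x: "x \<in> {t/2..1}"
      show "integral {t/2..x} v - integral {t/2..1} v = V x"
        using Henstock_Kurzweil_Integration.integral_combine[of "t/2" x 1 v] int_v[of "t/2" 1] x t
        by (simp add: V_def algebra_simps)
    qed (use t in auto)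
    moreover have "at t within {t/2..1} = at t within {0<..1}"
      using t by (intro at_within_nhd[of _ "{t/2<..<2}"]) auto
    ultimately show ?thesis by simp
  qed
  have g2_neg: "g2 t < 0" if "0 < t" "t \<le> t1" for t
  proof -
    have "g2 t \<le> g2 t1" using that t1 by (intro monotone_onD[OF g2_mono]) auto
    then show ?thesis using t1 by linarith
  qed
  have g3_nonneg: "g3 t \<ge> 0" if "0 < t" "t < 1" for t
  proof -
    have "(g2 has_real_derivative g3 t) (at t within {0<..<1})"
      using that by (intro has_field_derivative_subset[OF dg2]) auto
    then have "(g2 has_real_derivative g3 t) (at t)"
      using that by (simp add: at_within_open[of t "{0<..<1}"])
    moreover have "mono_on {0<..<1} g2"
      by (rule monotone_on_subset[OF g2_mono]) auto
    ultimately show ?thesis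
      using that mono_on_imp_deriv_nonneg[of "{0<..<1}" g2 "g3 t" t] by (simp add: interior_open)
  qed
  have tail: "integral {t..t1} v \<le> C powr \<mu> / (2 * \<mu>) * (- g2 t1) powr (-\<mu>)" if t: "0 < t" "t \<le> t1" for t
  proof -
    define H where "H x = C powr \<mu> / (2 * \<mu>) * (- g2 x) powr (-\<mu>)" for x
    define H' where "H' x = C powr \<mu> / 2 * g3 x * (- g2 x) powr (-\<mu> - 1)" for x
    have "(H has_real_derivative H' x) (at x within {t..t1})" if x: "x \<in> {t..t1}" for x
    proof -
      have "(g2 has_real_derivative g3 x) (at x within {t..t1})"
        using x t t1 by (intro has_field_derivative_subset[OF dg2]) auto
      then show ?thesis unfolding H_def H'_def using g2_neg[of x] x t \<mu>
        by (auto intro!: derivative_eq_intros)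
    qed
    then have H: "(H' has_integral (H t1 - H t)) {t..t1}"
      using t by (intro fundamental_theorem_of_calculus) (auto simp: has_real_derivative_iff_has_vector_derivative)
    have le: "v x \<le> H' x" if x: "x \<in> {t..t1}" for x
    proof -
      have x': "0 < x" "x \<le> t1" "x \<in> {0<..1}" "x < 1" "x \<le> t1" using x t t1 by auto
      \<comment> \<open>Raised to the power \<open>\<mu>\<close>, the bound on \<open>g2\<close>
        trades the weight \<open>g1 powr (-\<kappa>)\<close> for
        \<open>(- g2) powr (-\<mu>)\<close>, against which \<open>g3 / g2\<close> integrates
        exactly.\<close>
      have "(- g2 x) powr \<mu> \<le> (C * g1 x powr (2 * lam)) powr \<mu>"
        using g2_le[OF x'(1,2)] g2_neg[OF x'(1,5)] \<mu> by (intro powr_mono2) auto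
      also have "\<dots> = C powr \<mu> * g1 x powr \<kappa>"
        using params \<mu> g1_pos[OF x'(3)] by (simp add: powr_mult powr_powr)
      finally have "g1 x powr (-\<kappa>) \<le> C powr \<mu> * (- g2 x) powr (-\<mu>)"
        using g1_pos[OF x'(3)] g2_neg[OF x'(1,5)] by (simp add: powr_minus field_simps)
      then have "v x \<le> (1/2 * \<bar>g3 x / g2 x\<bar>) * (C powr \<mu> * (- g2 x) powr (-\<mu>))"
        unfolding v_def using p_le[OF x'(1,2)] by (intro mult_mono) auto
      also have "\<dots> = H' x"
        using g2_neg[OF x'(1,5)] g3_nonneg[OF x'(1,4)] powr_diff[of "- g2 x" "-\<mu>" 1]
        by (simp add: H'_def abs_divide)
      finally show ?thesis .
    qed
    have "integral {t..t1} v \<le> H t1 - H t"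
      using le H int_v[of t t1] t t1 by (intro has_integral_le[OF integrable_integral H]) auto
    also have "\<dots> \<le> H t1" using \<mu> by (simp add: H_def)
    finally show ?thesis by (simp add: H_def)
  qed
  have "- M \<le> V t \<and> V t \<le> 0" if t: "t \<in> {0<..1}" for t
  proof
    show "V t \<le> 0" unfolding V_def using v_nonneg int_v t by (auto intro!: integral_nonneg)
    show "- M \<le> V t"
    proof (cases "t \<le> t1")
      case True
      have "integral {t..1} v = integral {t..t1} v + integral {t1..1} v"
        using Henstock_Kurzweil_Integration.integral_combine[of t t1 1 v] int_v[of t 1] True t t1 by simp
      then show ?thesis using tail[of t] True t by (simp add: V_def M_def)
    next
      case False
      have "integral {t1..1} v = integral {t1..t} v + integral {t..1} v"
        using Henstock_Kurzweil_Integration.integral_combine[of t1 t 1 v] int_v[of t1 1] False t t1 by simp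
      moreover have "integral {t1..t} v \<ge> 0"
        using v_nonneg int_v t t1 by (intro integral_nonneg) auto
      moreover have "C powr \<mu> / (2 * \<mu>) * (- g2 t1) powr (-\<mu>) \<ge> 0" using \<mu> by simp
      ultimately show ?thesis by (simp add: V_def M_def)
    qed
  qed
  with dV show ?thesis unfolding v_def by blast
qed

text \<open>If \<open>g2 \<ge> - m\<close> throughout, the mean value theorem on
  \<open>{t..1}\<close> bounds \<open>g1 t\<close> uniformly in \<open>t\<close>, whereas the growth
  forces \<open>g1 t \<ge> c / t\<close>.\<close>

lemma growth_excludes_bounded_derivative:
  fixes g1 g2 :: "real \<Rightarrow> real"
  assumes d: "\<And>t. t \<in> {0<..1} \<Longrightarrow> (g1 has_real_derivative g2 t) (at t within {0<..1})"
    and growth: "\<And>r. r \<in> {0<..1} \<Longrightarrow> g1 r \<ge> c * r powr (-a)" and "c > 0" "a > 1"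
  shows "\<exists>t\<in>{0<..1}. g2 t < - m"
proof (rule ccontr)
  assume "\<not> (\<exists>t\<in>{0<..1}. g2 t < - m)"
  then have m: "g2 t \<ge> - m" if "t \<in> {0<..1}" for t using that by force
  \<comment> \<open>\<open>R\<close> exceeds the mean value bound for \<open>g1 t\<close>, while
    \<open>t \<le> c / (2 * R)\<close> forces \<open>g1 t \<ge> 2 * R\<close>.\<close>
  define R where "R = \<bar>g1 1\<bar> + \<bar>m\<bar> + 1"
  define t where "t = min (1 / 2) (c / (2 * R))"
  have R: "R > 0" by (simp add: R_def)
  have t: "0 < t" "t < 1" "t \<le> c / (2 * R)" using R \<open>c > 0\<close> by (auto simp: t_def min_less_iff_disj)
  have "\<exists>z\<in>{t<..<1}. g1 1 - g1 t = (\<lambda>h. h * g2 z) (1 - t)"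
  proof (rule mvt_simple)
    fix z assume "t \<le> z" "z \<le> 1"
    then have "(g1 has_real_derivative g2 z) (at z within {t..1})"
      using t by (intro has_field_derivative_subset[OF d]) auto
    then show "(g1 has_derivative (\<lambda>h. h * g2 z)) (at z within {t..1})"
      by (simp add: has_field_derivative_def mult_commute_abs)
  qed (use t in auto)
  then obtain z where z: "z \<in> {t<..<1}" "g1 1 - g1 t = (1 - t) * g2 z" by auto
  have "(1 - t) * g2 z \<ge> (1 - t) * (- m)"
    using m[of z] z t by (intro mult_left_mono) auto
  moreover have "(1 - t) * (- m) \<ge> - \<bar>m\<bar>"
  proof -
    have "(1 - t) * m \<le> (1 - t) * \<bar>m\<bar>" using t by (intro mult_left_mono) auto
    also have "\<dots> \<le> 1 * \<bar>m\<bar>" using t by (intro mult_right_mono) auto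
    finally show ?thesis by simp
  qed
  ultimately have "g1 t < R" using z by (simp add: R_def)
  moreover have "c * (1 / t) \<le> c * t powr (-a)"
  proof (rule mult_left_mono)
    have "t powr (-1) \<le> t powr (-a)" using t assms by (intro powr_mono') auto
    then show "1 / t \<le> t powr (-a)" using t by (simp add: powr_minus_divide)
  qed (use assms in auto)
  then have "c / t \<le> g1 t" using growth[of t] t by simp
  moreover have "c / t \<ge> 2 * R" using t R assms by (simp add: field_simps)
  ultimately show False using R by linarith
qed

subsection \<open>Dyadic stopping\<close>

text \<open>Cells are encoded by floors so that passing to a coarser cell is an integer division of
  indices.\<close>

definition dyadic :: "nat \<Rightarrow> int \<Rightarrow> real set" where
  "dyadic n k = {y. \<lfloor>2 ^ n * y\<rfloor> = k}"

lemma dyadic_eq_interval: "dyadic n k = {of_int k / 2 ^ n..<(of_int k + 1) / 2 ^ n}"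
  by (auto simp: dyadic_def floor_eq_iff field_simps)

lemma sets_dyadic [measurable]: "dyadic n k \<in> sets borel"
  by (simp add: dyadic_eq_interval)

lemma emeasure_dyadic: "emeasure lborel (dyadic n k) = ennreal (1 / 2 ^ n)"
  by (simp add: dyadic_eq_interval divide_right_mono flip: diff_divide_distrib)

lemma floor_dyadic_coarsen:
  fixes x :: real
  assumes "m \<le> n"
  shows "\<lfloor>2 ^ m * x\<rfloor> = \<lfloor>2 ^ n * x\<rfloor> div 2 ^ (n - m)"
proof -
  have "(2::real) ^ n = 2 ^ m * 2 ^ (n - m)" using assms by (simp flip: power_add)
  then have "2 ^ m * x = 2 ^ n * x / real_of_int (2 ^ (n - m))" by simp
  then show ?thesis by (simp only: floor_divide_real_eq_div zero_le_power zero_le_numeral)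
qed

text \<open>In the application \<open>\<mu>\<close> has density \<open>\<bar>f\<bar>\<close>, and
  cells of the last generation \<open>N\<close> are shorter than \<open>\<epsilon>\<close>.\<close>

locale dyadic_stopping =
  fixes \<mu> :: "real measure" and \<alpha> :: real and N :: nat
  assumes sets_\<mu> [measurable_cong]: "sets \<mu> = sets borel" and \<alpha>: "\<alpha> > 0"
begin

definition bad :: "nat \<Rightarrow> real \<Rightarrow> bool" where
  "bad n y \<longleftrightarrow> emeasure \<mu> (dyadic n \<lfloor>2 ^ n * y\<rfloor>) > ennreal (\<alpha> / 2 ^ n)"

text \<open>The stopping length is \<open>1 / 2 ^ \<nu> y\<close>. The disjunct \<open>n = N\<close>
  is the default stop when no earlier cell around \<open>y\<close> is heavy.\<close>

definition \<nu> :: "real \<Rightarrow> nat" where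
  "\<nu> y = (LEAST n. n = N \<or> bad n y)"

definition stopped :: "nat \<Rightarrow> real set" where
  "stopped n = {y. \<nu> y = n \<and> bad n y}"

text \<open>The selected heavy cells with their right neighbours: the kernel sends mass at
  \<open>y\<close> only to the right.\<close>

definition exceptional :: "real set" where
  "exceptional = (\<Union>n\<le>N. stopped n \<union> {x. x - 1 / 2 ^ n \<in> stopped n})"

lemma \<nu>_le: "\<nu> y \<le> N"
  unfolding \<nu>_def by (rule Least_le) simp

lemma \<nu>_cases: "\<nu> y = N \<or> bad (\<nu> y) y"
  unfolding \<nu>_def by (rule LeastI[of _ N]) simp

lemma not_bad_before: "m < \<nu> y \<Longrightarrow> \<not> bad m y"
  unfolding \<nu>_def using not_less_Least by blast

text \<open>In this form stopping at \<open>n\<close> visibly depends only on cells of generation at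
  most \<open>n\<close>; the clause \<open>m \<noteq> N\<close> encodes
  \<open>n \<le> N\<close>.\<close>

lemma \<nu>_eq_iff: "\<nu> y = n \<longleftrightarrow> (n = N \<or> bad n y) \<and> (\<forall>m<n. m \<noteq> N \<and> \<not> bad m y)"
proof
  assume "\<nu> y = n"
  then show "(n = N \<or> bad n y) \<and> (\<forall>m<n. m \<noteq> N \<and> \<not> bad m y)"
    using \<nu>_cases[of y] not_bad_before[of _ y] \<nu>_le[of y] by auto
next
  assume "(n = N \<or> bad n y) \<and> (\<forall>m<n. m \<noteq> N \<and> \<not> bad m y)"
  then show "\<nu> y = n"
    unfolding \<nu>_def by (intro Least_equality) (auto simp: not_less[symmetric])
qed

lemma measurable_bad [measurable]: "Measurable.pred borel (bad n)"
proof -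
  have "(\<lambda>y::real. \<lfloor>2 ^ n * y\<rfloor>) \<in> measurable borel (count_space UNIV)" by measurable
  then show ?thesis unfolding bad_def by measurable
qed

lemma measurable_\<nu> [measurable]: "\<nu> \<in> measurable borel (count_space UNIV)"
  unfolding \<nu>_def[abs_def] by measurable

lemma sets_stopped [measurable]: "stopped n \<in> sets borel"
  unfolding stopped_def by measurable

lemma sets_exceptional [measurable]: "exceptional \<in> sets borel"
  unfolding exceptional_def by measurable

text \<open>Points in one cell of generation \<open>n\<close> share all coarser cells too, hence the
  whole history of heaviness up to \<open>n\<close>.\<close>

lemma stopped_saturated:
  assumes "y \<in> stopped n" "\<lfloor>2 ^ n * x\<rfloor> = \<lfloor>2 ^ n * y\<rfloor>"
  shows "x \<in> stopped n"
proof -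
  have "bad m x = bad m y" if "m \<le> n" for m
    using assms(2) floor_dyadic_coarsen[OF that] by (simp add: bad_def)
  then show ?thesis using assms(1) by (simp add: stopped_def \<nu>_eq_iff)
qed

text \<open>By saturation the set is a countable disjoint union of cells, each with mass above
  \<open>\<alpha>\<close> times its length.\<close>

lemma emeasure_stopped: "\<alpha> * emeasure lborel (stopped n) \<le> emeasure \<mu> (stopped n)"
proof -
  define S where "S = {k. \<exists>y\<in>stopped n. \<lfloor>2 ^ n * y\<rfloor> = k}"
  have eq: "stopped n = (\<Union>k\<in>S. dyadic n k)"
    using stopped_saturated by (auto simp: S_def dyadic_def)
  have disj: "disjoint_family_on (dyadic n) S"
    by (auto simp: disjoint_family_on_def dyadic_def)
  have "\<alpha> * emeasure lborel (stopped n) = \<alpha> * (\<integral>\<^sup>+k. emeasure lborel (dyadic n k) \<partial>count_space S)"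
    unfolding eq by (subst emeasure_UN_countable) (auto intro: disj)
  also have "\<dots> = (\<integral>\<^sup>+k. \<alpha> * emeasure lborel (dyadic n k) \<partial>count_space S)"
    by (simp add: nn_integral_cmult)
  also have "\<dots> \<le> (\<integral>\<^sup>+k. emeasure \<mu> (dyadic n k) \<partial>count_space S)"
  proof (intro nn_integral_mono)
    fix k assume "k \<in> space (count_space S)"
    then obtain y where "bad n y" "\<lfloor>2 ^ n * y\<rfloor> = k" by (auto simp: S_def stopped_def)
    then show "\<alpha> * emeasure lborel (dyadic n k) \<le> emeasure \<mu> (dyadic n k)"
      using \<alpha> by (simp add: bad_def emeasure_dyadic flip: ennreal_mult)
  qed
  also have "\<dots> = emeasure \<mu> (stopped n)"
    unfolding eq by (subst emeasure_UN_countable) (auto intro: disj)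
  finally show ?thesis .
qed

text \<open>The sets \<open>stopped n\<close> are disjoint, so their masses add up to at most the
  total; the translates account for the factor \<open>2\<close>.\<close>

lemma emeasure_exceptional: "\<alpha> * emeasure lborel exceptional \<le> 2 * emeasure \<mu> UNIV"
proof -
  have shift: "emeasure lborel {x. x - 1 / 2 ^ n \<in> stopped n} = emeasure lborel (stopped n)" for n
  proof -
    have "emeasure lborel (stopped n) = emeasure (distr lborel borel ((+) (- (1 / 2 ^ n)))) (stopped n)"
      by (simp add: lborel_distr_plus)
    also have "\<dots> = emeasure lborel {x. x - 1 / 2 ^ n \<in> stopped n}"
      by (subst emeasure_distr) (auto simp: vimage_def)
    finally show ?thesis by simp
  qed
  have "emeasure lborel exceptional \<le> (\<Sum>n\<le>N. emeasure lborel (stopped n \<union> {x. x - 1 / 2 ^ n \<in> stopped n}))"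
    unfolding exceptional_def by (rule emeasure_subadditive_finite) auto
  also have "\<dots> \<le> (\<Sum>n\<le>N. emeasure lborel (stopped n) + emeasure lborel {x. x - 1 / 2 ^ n \<in> stopped n})"
    by (intro sum_mono emeasure_subadditive) auto
  also have "\<dots> = 2 * (\<Sum>n\<le>N. emeasure lborel (stopped n))"
    by (simp add: shift sum_distrib_left mult_2)
  finally have "\<alpha> * emeasure lborel exceptional \<le> \<alpha> * (2 * (\<Sum>n\<le>N. emeasure lborel (stopped n)))"
    by (rule mult_left_mono) simp
  also have "\<dots> = 2 * (\<Sum>n\<le>N. \<alpha> * emeasure lborel (stopped n))"
    by (simp add: sum_distrib_left mult_ac)
  also have "\<dots> \<le> 2 * (\<Sum>n\<le>N. emeasure \<mu> (stopped n))"
    by (intro mult_left_mono sum_mono emeasure_stopped) simp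
  also have "(\<Sum>n\<le>N. emeasure \<mu> (stopped n)) = emeasure \<mu> (\<Union>n\<le>N. stopped n)"
    by (rule sum_emeasure) (auto simp: disjoint_family_on_def stopped_def sets_\<mu>)
  also have "\<dots> \<le> emeasure \<mu> UNIV"
    by (rule emeasure_mono) (auto simp: sets_\<mu>)
  finally show ?thesis by (simp add: mult_left_mono)
qed

text \<open>Moving right by at most one cell length, endpoint included, ends in the cell of
  \<open>y\<close> or in the next one.\<close>

lemma in_exceptional:
  assumes bad: "bad (\<nu> y) y" and x: "y \<le> x" "x \<le> y + 1 / 2 ^ \<nu> y"
  shows "x \<in> exceptional"
proof -
  define n where "n = \<nu> y"
  have y: "y \<in> stopped n" using bad by (simp add: stopped_def n_def)
  have "x \<in> stopped n \<or> x - 1 / 2 ^ n \<in> stopped n"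
  proof (cases "\<lfloor>2 ^ n * x\<rfloor> = \<lfloor>2 ^ n * y\<rfloor>")
    case True
    then show ?thesis using stopped_saturated[OF y] by blast
  next
    case False
    have "2 ^ n * y \<le> 2 ^ n * x" "2 ^ n * x \<le> 2 ^ n * y + 1"
      using x by (auto simp: n_def field_simps)
    then have "\<lfloor>2 ^ n * y\<rfloor> \<le> \<lfloor>2 ^ n * x\<rfloor>" "\<lfloor>2 ^ n * x\<rfloor> \<le> \<lfloor>2 ^ n * y + 1\<rfloor>"
      by linarith+
    then have "\<lfloor>2 ^ n * x - 1\<rfloor> = \<lfloor>2 ^ n * y\<rfloor>" using False by simp
    then have "\<lfloor>2 ^ n * (x - 1 / 2 ^ n)\<rfloor> = \<lfloor>2 ^ n * y\<rfloor>" by (simp add: right_diff_distrib)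
    then show ?thesis using stopped_saturated[OF y] by blast
  qed
  then show ?thesis using \<nu>_le[of y] by (auto simp: exceptional_def n_def)
qed

text \<open>The parent cell comes before the stop, so it is not heavy; being twice as long, it costs
  the factor \<open>2\<close>.\<close>

lemma emeasure_dyadic_unstopped:
  assumes "1 \<le> n" "j \<le> n"
  shows "emeasure \<mu> (dyadic j k \<inter> {y. n \<le> \<nu> y}) \<le> ennreal (2 * \<alpha> / 2 ^ j)"
proof (cases "dyadic j k \<inter> {y. n \<le> \<nu> y} = {}")
  case False
  then obtain y where y: "y \<in> dyadic j k" "n \<le> \<nu> y" by auto
  \<comment> \<open>For \<open>j = 0\<close> truncated subtraction gives the cell itself, which is
    not heavy because \<open>1 \<le> n\<close>.\<close>
  define i where "i = j - 1"
  have "\<not> bad i y" using y assms by (intro not_bad_before) (auto simp: i_def)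
  then have "emeasure \<mu> (dyadic i \<lfloor>2 ^ i * y\<rfloor>) \<le> ennreal (\<alpha> / 2 ^ i)"
    by (simp add: bad_def not_less)
  moreover have "\<alpha> / 2 ^ i \<le> 2 * \<alpha> / 2 ^ j"
    using \<alpha> by (cases j) (auto simp: i_def)
  moreover have "dyadic j k \<inter> {y. n \<le> \<nu> y} \<subseteq> dyadic i \<lfloor>2 ^ i * y\<rfloor>"
    using y floor_dyadic_coarsen[of i j] by (auto simp: dyadic_def i_def)
  then have "emeasure \<mu> (dyadic j k \<inter> {y. n \<le> \<nu> y}) \<le> emeasure \<mu> (dyadic i \<lfloor>2 ^ i * y\<rfloor>)"
    by (rule emeasure_mono) (simp add: sets_\<mu>)
  ultimately show ?thesis by (meson ennreal_leI order_trans)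
qed simp

text \<open>The interval meets at most three cells of generation \<open>j\<close>, which turns the
  constant \<open>2\<close> into \<open>6\<close>.\<close>

lemma emeasure_interval_unstopped:
  assumes "1 \<le> n" "j \<le> n"
  shows "emeasure \<mu> {y. n \<le> \<nu> y \<and> \<bar>y - z\<bar> \<le> 1 / 2 ^ j} \<le> ennreal (6 * \<alpha> / 2 ^ j)"
proof -
  define k where "k = \<lfloor>2 ^ j * z\<rfloor>"
  let ?D = "\<lambda>i. dyadic j i \<inter> {y. n \<le> \<nu> y}"
  have "{y. n \<le> \<nu> y \<and> \<bar>y - z\<bar> \<le> 1 / 2 ^ j} \<subseteq> (\<Union>i\<in>{k - 1, k, k + 1}. ?D i)"
  proof
    fix y assume y: "y \<in> {y. n \<le> \<nu> y \<and> \<bar>y - z\<bar> \<le> 1 / 2 ^ j}"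
    then have "z - 1 / 2 ^ j \<le> y" "y \<le> z + 1 / 2 ^ j" by (auto simp: abs_le_iff)
    then have "2 ^ j * (z - 1 / 2 ^ j) \<le> 2 ^ j * y" "2 ^ j * y \<le> 2 ^ j * (z + 1 / 2 ^ j)"
      by (auto intro: mult_left_mono)
    then have "2 ^ j * z - 1 \<le> 2 ^ j * y" "2 ^ j * y \<le> 2 ^ j * z + 1"
      by (auto simp: right_diff_distrib distrib_left)
    then have "\<lfloor>2 ^ j * z - 1\<rfloor> \<le> \<lfloor>2 ^ j * y\<rfloor>" "\<lfloor>2 ^ j * y\<rfloor> \<le> \<lfloor>2 ^ j * z + 1\<rfloor>"
      by linarith+
    then have "\<lfloor>2 ^ j * y\<rfloor> \<in> {k - 1, k, k + 1}" by (auto simp: k_def)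
    then show "y \<in> (\<Union>i\<in>{k - 1, k, k + 1}. ?D i)" using y by (auto simp: dyadic_def)
  qed
  then have "emeasure \<mu> {y. n \<le> \<nu> y \<and> \<bar>y - z\<bar> \<le> 1 / 2 ^ j} \<le> emeasure \<mu> (\<Union>i\<in>{k - 1, k, k + 1}. ?D i)"
    by (rule emeasure_mono) measurable
  also have "\<dots> \<le> (\<Sum>i\<in>{k - 1, k, k + 1}. emeasure \<mu> (?D i))"
    by (rule emeasure_subadditive_finite) (auto simp: sets_\<mu>)
  also have "\<dots> \<le> (\<Sum>i\<in>{k - 1, k, k + 1}. ennreal (2 * \<alpha> / 2 ^ j))"
    by (intro sum_mono emeasure_dyadic_unstopped assms)
  also have "\<dots> = 3 * ennreal (2 * \<alpha> / 2 ^ j)" by simp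
  also have "\<dots> = ennreal (6 * \<alpha> / 2 ^ j)"
    using \<alpha> ennreal_mult[of 3 "2 * \<alpha> / 2 ^ j"] by simp
  finally show ?thesis .
qed

end

subsection \<open>Weak type bounds from correlation estimates\<close>

lemma norm_integral_le_nn_integral:
  fixes f :: "_ \<Rightarrow> 'b::{banach, second_countable_topology}"
  shows "ennreal (norm (integral\<^sup>L M f)) \<le> (\<integral>\<^sup>+x. norm (f x) \<partial>M)"
proof (cases "integrable M f")
  case True
  then show ?thesis by (rule integral_norm_bound_ennreal)
qed (simp add: not_integrable_integral_eq)

text \<open>For fixed \<open>y\<close> the variable \<open>x\<close> runs over a strip of length
  one, so Tonelli reduces the claim to the integrability of \<open>g\<close>. The offset
  \<open>a\<close> admits strips that move with \<open>y\<close> as well as fixed ones.\<close>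

lemma integrable_pair_lborelI:
  fixes H :: "real \<Rightarrow> real \<Rightarrow> complex" and g :: "real \<Rightarrow> complex"
  assumes [measurable]: "(\<lambda>(x, y). H x y) \<in> borel_measurable (lborel \<Otimes>\<^sub>M lborel)"
    and le: "\<And>x y. norm (H x y) \<le> C * norm (g y) * indicator {a y..a y + 1} x" and "C \<ge> 0"
    and g: "integrable lborel g"
  shows "integrable (lborel \<Otimes>\<^sub>M lborel) (\<lambda>(x, y). H x y)"
proof (rule integrableI_bounded)
  have [measurable]: "g \<in> borel_measurable lborel" using g by auto
  have "(\<integral>\<^sup>+p. ennreal (norm (case p of (x, y) \<Rightarrow> H x y)) \<partial>(lborel \<Otimes>\<^sub>M lborel))
      = (\<integral>\<^sup>+y. (\<integral>\<^sup>+x. ennreal (norm (H x y)) \<partial>lborel) \<partial>lborel)"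
    by (subst lborel_pair.nn_integral_snd[symmetric]) auto
  also have "\<dots> \<le> (\<integral>\<^sup>+y. ennreal (C * norm (g y)) \<partial>lborel)"
  proof (intro nn_integral_mono)
    fix y :: real
    have "(\<integral>\<^sup>+x. ennreal (norm (H x y)) \<partial>lborel)
        \<le> (\<integral>\<^sup>+x. ennreal (C * norm (g y)) * indicator {a y..a y + 1} x \<partial>lborel)"
    proof (intro nn_integral_mono)
      fix x
      show "ennreal (norm (H x y)) \<le> ennreal (C * norm (g y)) * indicator {a y..a y + 1} x"
        using ennreal_leI[OF le[of x y]] by (cases "x \<in> {a y..a y + 1}") auto
    qed
    also have "\<dots> = ennreal (C * norm (g y))"
      by (simp add: nn_integral_cmult_indicator)
    finally show "(\<integral>\<^sup>+x. ennreal (norm (H x y)) \<partial>lborel) \<le> ennreal (C * norm (g y))" .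
  qed
  also have "\<dots> < \<infinity>"
  proof -
    have "(\<integral>\<^sup>+y. ennreal (norm (C * norm (g y))) \<partial>lborel) < \<infinity>"
      using integrable_mult_right[OF integrable_norm[OF g], of C] unfolding integrable_iff_bounded by blast
    moreover have "norm (C * norm (g y)) = C * norm (g y)" for y using \<open>C \<ge> 0\<close> by simp
    ultimately show ?thesis by (simp only:)
  qed
  finally show "(\<integral>\<^sup>+p. ennreal (norm (case p of (x, y) \<Rightarrow> H x y)) \<partial>(lborel \<Otimes>\<^sub>M lborel)) < \<infinity>" .
qed measurable

text \<open>The square is written as \<open>S * cnj S\<close>. A first exchange of integrals opens
  \<open>S\<close>, a second one opens \<open>cnj S\<close>, and what remains inside is the
  correlation of two columns of the kernel.\<close>

lemma kernel_operator_L2_le: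
  fixes k :: "real \<Rightarrow> real \<Rightarrow> complex" and f :: "real \<Rightarrow> complex"
  assumes k[measurable]: "(\<lambda>(x, y). k x y) \<in> borel_measurable (lborel \<Otimes>\<^sub>M lborel)"
    and k_le: "\<And>x y. norm (k x y) \<le> R * indicator {y..y + 1} x"
    and f: "integrable lborel f"
  shows "(\<integral>\<^sup>+x. ennreal ((norm (LINT y|lborel. k x y * f y))\<^sup>2) \<partial>lborel)
    \<le> (\<integral>\<^sup>+y. ennreal (norm (f y)) *
        (\<integral>\<^sup>+z. ennreal (norm (f z)) * ennreal (norm (LINT x|lborel. k x y * cnj (k x z))) \<partial>lborel) \<partial>lborel)"
proof -
  define S where "S x = (LINT y|lborel. k x y * f y)" for x
  define F where "F = (LINT y|lborel. norm (f y))"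
  define \<Lambda> where "\<Lambda> y z = (LINT x|lborel. k x y * cnj (k x z))" for y z
  have fm[measurable]: "f \<in> borel_measurable lborel" using f by auto
  have Sm[measurable]: "S \<in> borel_measurable lborel" unfolding S_def by measurable
  have R: "R \<ge> 0" using order_trans[OF norm_ge_zero k_le[of 0 0]] by simp
  have cnj_meas[measurable]: "cnj \<in> borel_measurable borel"
    by (intro borel_measurable_continuous_onI continuous_intros)
  have ky[measurable]: "(\<lambda>x. k x y) \<in> borel_measurable lborel" for y
  proof -
    have "(\<lambda>x. (x, y)) \<in> lborel \<rightarrow>\<^sub>M lborel \<Otimes>\<^sub>M lborel" by measurable
    from measurable_compose[OF this k] show ?thesis by simp
  qed
  have k_le': "norm (k x y) \<le> R" for x y
    using k_le[of x y] R by (cases "x \<in> {y..y + 1}") auto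
  have F: "F \<ge> 0" by (simp add: F_def)
  have S_le: "norm (S x) \<le> R * F" for x
  proof -
    have "norm (S x) \<le> (LINT y|lborel. R * norm (f y))"
      unfolding S_def
    proof (rule Bochner_Integration.integral_norm_bound_integral)
      show "integrable lborel (\<lambda>y. k x y * f y)"
        using k_le' R by (intro Bochner_Integration.integrable_bound[OF integrable_mult_right[OF integrable_norm[OF f], of R]])
          (auto simp: norm_mult mult_right_mono)
    qed (use f k_le' in \<open>auto simp: norm_mult mult_right_mono\<close>)
    then show ?thesis by (simp add: F_def)
  qed
  \<comment> \<open>\<open>S\<close> is bounded by \<open>R * F\<close>, so \<open>cnj S\<close> can
    stand as a mere factor in the first exchange.\<close>
  have I1: "integrable (lborel \<Otimes>\<^sub>M lborel) (\<lambda>(x, y). k x y * f y * cnj (S x))"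
  proof (rule integrable_pair_lborelI[where C = "R * (R * F)" and a = "\<lambda>y. y", OF _ _ _ f])
    fix x y
    have "norm (k x y * f y * cnj (S x)) \<le> (R * indicator {y..y + 1} x) * norm (f y) * (R * F)"
      unfolding norm_mult complex_mod_cnj using R F
      by (intro mult_mono k_le S_le order_refl) auto
    then show "norm (k x y * f y * cnj (S x)) \<le> R * (R * F) * norm (f y) * indicator {y..y + 1} x"
      by (simp add: mult_ac)
  qed (measurable, use R F in simp)
  have I2: "integrable (lborel \<Otimes>\<^sub>M lborel) (\<lambda>(x, z). k x y * (cnj (k x z) * cnj (f z)))" for y
  proof (rule integrable_pair_lborelI[where C = "R * R" and a = "\<lambda>_. y", OF _ _ _ f])
    fix x z
    have "norm (k x y * (cnj (k x z) * cnj (f z))) \<le> (R * indicator {y..y + 1} x) * (R * norm (f z))"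
      unfolding norm_mult complex_mod_cnj using R
      by (intro mult_mono k_le k_le' order_refl) auto
    then show "norm (k x y * (cnj (k x z) * cnj (f z))) \<le> R * R * norm (f z) * indicator {y..y + 1} x"
      by (simp add: mult_ac)
    have 1: "(\<lambda>p. k (fst p) y) \<in> borel_measurable (lborel \<Otimes>\<^sub>M lborel)"
      by (rule measurable_compose[OF measurable_fst ky])
    have 2: "(\<lambda>p. f (snd p)) \<in> borel_measurable (lborel \<Otimes>\<^sub>M lborel)"
      by (rule measurable_compose[OF measurable_snd fm])
    show "(\<lambda>(x, z). k x y * (cnj (k x z) * cnj (f z))) \<in> borel_measurable (lborel \<Otimes>\<^sub>M lborel)"
      using borel_measurable_times[OF 1 borel_measurable_times[OF
          measurable_compose[OF k cnj_meas] measurable_compose[OF 2 cnj_meas]]]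
      by (simp add: case_prod_beta')
  qed (use R in simp)
  have inner: "(LINT x|lborel. k x y * cnj (S x)) = (LINT z|lborel. \<Lambda> y z * cnj (f z))" for y
  proof -
    have "(LINT x|lborel. k x y * cnj (S x)) = (LINT x|lborel. LINT z|lborel. k x y * (cnj (k x z) * cnj (f z)))"
      by (simp add: S_def flip: Bochner_Integration.integral_cnj)
    also have "\<dots> = (LINT z|lborel. LINT x|lborel. k x y * (cnj (k x z) * cnj (f z)))"
      by (rule lborel_pair.Fubini_integral[OF I2[of y], symmetric])
    also have "\<dots> = (LINT z|lborel. \<Lambda> y z * cnj (f z))"
      by (simp add: \<Lambda>_def flip: mult.assoc)
    finally show ?thesis .
  qed
  have sq: "S x * cnj (S x) = of_real ((norm (S x))\<^sup>2)" for x
    by (simp only: complex_norm_square)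
  have yint: "(LINT y|lborel. k x y * f y * cnj (S x)) = of_real ((norm (S x))\<^sup>2)" for x
    unfolding sq[symmetric] by (simp add: S_def)
  have "integrable lborel (\<lambda>x. complex_of_real ((norm (S x))\<^sup>2))"
    using lborel_pair.integrable_fst'[OF I1] by (simp only: prod.case yint)
  then have int_sq: "integrable lborel (\<lambda>x. (norm (S x))\<^sup>2)"
    by (simp only: complex_of_real_integrable_eq)
  have "complex_of_real (LINT x|lborel. (norm (S x))\<^sup>2) = (LINT x|lborel. LINT y|lborel. k x y * f y * cnj (S x))"
    by (simp only: yint integral_complex_of_real)
  also have "\<dots> = (LINT y|lborel. LINT x|lborel. k x y * f y * cnj (S x))"
    by (rule lborel_pair.Fubini_integral[OF I1, symmetric])
  also have "\<dots> = (LINT y|lborel. f y * (LINT x|lborel. k x y * cnj (S x)))"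
    by (intro Bochner_Integration.integral_cong refl)
      (simp add: mult_ac flip: Bochner_Integration.integral_mult_right_zero)
  finally have eq: "complex_of_real (LINT x|lborel. (norm (S x))\<^sup>2) = (LINT y|lborel. f y * (LINT z|lborel. \<Lambda> y z * cnj (f z)))"
    by (simp only: inner)
  have "(\<integral>\<^sup>+x. ennreal ((norm (S x))\<^sup>2) \<partial>lborel) = ennreal (LINT x|lborel. (norm (S x))\<^sup>2)"
    by (rule nn_integral_eq_integral[OF int_sq]) simp
  also have "\<dots> = ennreal (norm (complex_of_real (LINT x|lborel. (norm (S x))\<^sup>2)))"
    by simp
  also have "\<dots> \<le> (\<integral>\<^sup>+y. norm (f y * (LINT z|lborel. \<Lambda> y z * cnj (f z))) \<partial>lborel)"
    unfolding eq by (rule norm_integral_le_nn_integral)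
  also have "\<dots> \<le> (\<integral>\<^sup>+y. ennreal (norm (f y)) * (\<integral>\<^sup>+z. ennreal (norm (f z)) * ennreal (norm (\<Lambda> y z)) \<partial>lborel) \<partial>lborel)"
  proof (intro nn_integral_mono)
    fix y
    have "ennreal (norm (LINT z|lborel. \<Lambda> y z * cnj (f z))) \<le> (\<integral>\<^sup>+z. norm (\<Lambda> y z * cnj (f z)) \<partial>lborel)"
      by (rule norm_integral_le_nn_integral)
    also have "\<dots> = (\<integral>\<^sup>+z. ennreal (norm (f z)) * ennreal (norm (\<Lambda> y z)) \<partial>lborel)"
      by (simp add: norm_mult ennreal_mult mult.commute)
    finally show "ennreal (norm (f y * (LINT z|lborel. \<Lambda> y z * cnj (f z))))
        \<le> ennreal (norm (f y)) * (\<integral>\<^sup>+z. ennreal (norm (f z)) * ennreal (norm (\<Lambda> y z)) \<partial>lborel)"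
      by (simp add: norm_mult ennreal_mult mult_left_mono)
  qed
  finally show ?thesis unfolding S_def \<Lambda>_def .
qed

section \<open>Truncated kernels and a dyadic majorant of their correlations\<close>

definition truncated :: "(real \<Rightarrow> complex) \<Rightarrow> real \<Rightarrow> real \<Rightarrow> complex" where
  "truncated K h t = (if h < t then K t else 0)"

text \<open>Measured from the right one of the two centres, both cuts merge into
  \<open>r > c\<close>. If \<open>z\<close> is on the right, \<open>c = h'\<close>; otherwise
  \<open>c = max h (h' - \<bar>y - z\<bar>)\<close>, which is at least \<open>h' / 2\<close> for
  centres at distance at most \<open>h' / 2\<close>.\<close>

lemma correlation_truncated:
  fixes K :: "real \<Rightarrow> complex"
  assumes "0 < h" "h \<le> h'"
  obtains c where "c > 0" "\<bar>y - z\<bar> \<le> h' / 2 \<Longrightarrow> h' / 2 \<le> c"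
    "norm (LINT x|lborel. truncated K h (x - y) * cnj (truncated K h' (x - z)))
      = norm (LINT r|lborel. indicator {c<..} r *\<^sub>R (K (r + \<bar>y - z\<bar>) * cnj (K r)))"
proof (cases "y \<le> z")
  case True
  have "(LINT x|lborel. truncated K h (x - y) * cnj (truncated K h' (x - z)))
      = (LINT r|lborel. truncated K h (z + r - y) * cnj (truncated K h' (z + r - z)))"
    using lborel_integral_real_affine[of 1 "\<lambda>x. truncated K h (x - y) * cnj (truncated K h' (x - z))" z] by simp
  also have "\<dots> = (LINT r|lborel. indicator {h'<..} r *\<^sub>R (K (r + \<bar>y - z\<bar>) * cnj (K r)))"
    using True assms
    by (intro Bochner_Integration.integral_cong) (auto simp: truncated_def indicator_def algebra_simps)
  finally show ?thesis using assms by (intro that[of h']) auto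
next
  case False
  define c where "c = max h (h' - \<bar>y - z\<bar>)"
  have "(LINT x|lborel. truncated K h (x - y) * cnj (truncated K h' (x - z)))
      = (LINT r|lborel. truncated K h (y + r - y) * cnj (truncated K h' (y + r - z)))"
    using lborel_integral_real_affine[of 1 "\<lambda>x. truncated K h (x - y) * cnj (truncated K h' (x - z))" y] by simp
  also have "\<dots> = (LINT r|lborel. cnj (indicator {c<..} r *\<^sub>R (K (r + \<bar>y - z\<bar>) * cnj (K r))))"
    using False
    by (intro Bochner_Integration.integral_cong) (auto simp: truncated_def indicator_def c_def algebra_simps)
  also have "norm \<dots> = norm (LINT r|lborel. indicator {c<..} r *\<^sub>R (K (r + \<bar>y - z\<bar>) * cnj (K r)))"
    by (simp only: Bochner_Integration.integral_cnj complex_mod_cnj)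
  finally have eq: "norm (LINT x|lborel. truncated K h (x - y) * cnj (truncated K h' (x - z)))
      = norm (LINT r|lborel. indicator {c<..} r *\<^sub>R (K (r + \<bar>y - z\<bar>) * cnj (K r)))" .
  have "h \<le> c" "h' - \<bar>y - z\<bar> \<le> c" by (simp_all add: c_def)
  then show ?thesis using assms by (intro that[of c, OF _ _ eq]) linarith+
qed

text \<open>A staircase in place of \<open>u powr (-\<theta>)\<close>, made of indicators of
  intervals whose mass is under control; the first term covers separations below the stopping
  length. For \<open>n = 0\<close> truncation at \<open>1\<close> removes the whole kernel.\<close>

definition weight :: "real \<Rightarrow> real \<Rightarrow> nat \<Rightarrow> real \<Rightarrow> real" where
  "weight B \<theta> n u = (if n = 0 then 0 else
     2 * B * 2 ^ n * indicator {..1 / 2 ^ n} u + (\<Sum>j\<le>n. 4 * B * 2 powr (\<theta> * j) * indicator {..1 / 2 ^ j} u))"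

lemma weight_nonneg: "B \<ge> 0 \<Longrightarrow> 0 \<le> weight B \<theta> n u"
  by (auto simp: weight_def intro!: add_nonneg_nonneg sum_nonneg)

lemma measurable_weight [measurable]: "weight B \<theta> n \<in> borel_measurable borel"
  unfolding weight_def[abs_def] by measurable

text \<open>\<open>n\<close> belongs to the longer stopping length. Separations up to half of it use
  \<open>near\<close>, larger ones up to \<open>1\<close> use \<open>far\<close> on a dyadic shell,
  and beyond \<open>1\<close> the supports of the two factors are disjoint.\<close>

lemma correlation_le_weight:
  fixes K :: "real \<Rightarrow> complex"
  assumes eps: "\<epsilon> > 0" and K_supp: "\<And>x. K x \<noteq> 0 \<Longrightarrow> \<epsilon> \<le> x \<and> x \<le> 1"
    and params: "0 \<le> \<theta>" "\<theta> < 1" "B \<ge> 0"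
    and far: "\<And>c u. 0 \<le> c \<Longrightarrow> 0 < u \<Longrightarrow> u \<le> 1 \<Longrightarrow>
      norm (LINT r|lborel. indicator {c<..} r *\<^sub>R (K (r + u) * cnj (K r))) \<le> B * u powr (-\<theta>)"
    and near: "\<And>c u. 0 < c \<Longrightarrow> 0 \<le> u \<Longrightarrow>
      norm (LINT r|lborel. indicator {c<..} r *\<^sub>R (K (r + u) * cnj (K r))) \<le> B / c"
    and "n \<le> m"
  shows "norm (LINT x|lborel. truncated K (1 / 2 ^ m) (x - y) * cnj (truncated K (1 / 2 ^ n) (x - z)))
    \<le> weight B \<theta> n \<bar>y - z\<bar>"
proof (cases "n = 0")
  case True
  have "truncated K 1 t = 0" for t using K_supp[of t] by (force simp: truncated_def)
  then show ?thesis using True by (simp add: weight_def)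
next
  case False
  define u where "u = \<bar>y - z\<bar>"
  have h: "0 < 1 / (2::real) ^ m" "1 / (2::real) ^ m \<le> 1 / 2 ^ n"
    using \<open>n \<le> m\<close> by (auto intro!: frac_le power_increasing)
  obtain c where c: "c > 0" "u \<le> 1 / 2 ^ n / 2 \<Longrightarrow> 1 / 2 ^ n / 2 \<le> c"
    and eq: "norm (LINT x|lborel. truncated K (1 / 2 ^ m) (x - y) * cnj (truncated K (1 / 2 ^ n) (x - z)))
      = norm (LINT r|lborel. indicator {c<..} r *\<^sub>R (K (r + u) * cnj (K r)))"
    using correlation_truncated[OF h, of y z K] unfolding u_def by blast
  have sum_ge: "(\<Sum>j\<le>n. 4 * B * 2 powr (\<theta> * j) * indicator {..1 / 2 ^ j} u) \<ge> 0"
    using params by (intro sum_nonneg) auto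
  consider "u \<le> 1 / 2 ^ n / 2" | "1 / 2 ^ n / 2 < u" "u \<le> 1" | "u > 1" by linarith
  then have "norm (LINT r|lborel. indicator {c<..} r *\<^sub>R (K (r + u) * cnj (K r))) \<le> weight B \<theta> n u"
  proof cases
    case 1
    have "norm (LINT r|lborel. indicator {c<..} r *\<^sub>R (K (r + u) * cnj (K r))) \<le> B / c"
      using near[of c u] c by (simp add: u_def)
    also have "\<dots> \<le> B / (1 / 2 ^ n / 2)" using c 1 params by (intro divide_left_mono) auto
    also have "\<dots> = 2 * B * 2 ^ n" by simp
    also have "\<dots> = 2 * B * 2 ^ n * indicator {..1 / 2 ^ n} u"
    proof -
      have half: "x / 2 \<le> x" if "0 \<le> x" for x :: real using that by simp
      have "u \<le> 1 / 2 ^ n" using order_trans[OF 1 half[of "1 / 2 ^ n"]] by simp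
      then show ?thesis by simp
    qed
    also have "\<dots> \<le> weight B \<theta> n u" using False sum_ge by (simp add: weight_def)
    finally show ?thesis .
  next
    case 2
    \<comment> \<open>The shell is \<open>1 / 2 ^ (j + 1) < u \<le> 1 / 2 ^ j\<close>. At the cap
      \<open>j = n\<close> its lower end comes from the case assumption instead of
      maximality.\<close>
    define j where "j = (GREATEST j. u \<le> 1 / 2 ^ j \<and> j \<le> n)"
    have "u \<le> 1 / 2 ^ j \<and> j \<le> n"
      unfolding j_def by (rule GreatestI_nat[of _ 0 n]) (use 2 in auto)
    then have j: "u \<le> 1 / 2 ^ j" "j \<le> n" by auto
    have "1 / 2 ^ (j + 1) < u"
    proof (rule ccontr)
      assume "\<not> 1 / 2 ^ (j + 1) < u"
      then have u: "u \<le> 1 / 2 ^ (j + 1)" by simp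
      show False
      proof (cases "j = n")
        case True
        then show False using u 2 by simp
      next
        case False
        then have "j + 1 \<le> j"
          using u j unfolding j_def by (intro Greatest_le_nat[of _ _ n]) auto
        then show False by simp
      qed
    qed
    have "norm (LINT r|lborel. indicator {c<..} r *\<^sub>R (K (r + u) * cnj (K r))) \<le> B * u powr (-\<theta>)"
      using far[of c u] c 2 order.strict_trans[of 0 "1 / 2 ^ n / 2" u] by simp
    also have "u powr (-\<theta>) \<le> (1 / 2 ^ (j + 1)) powr (-\<theta>)"
      using \<open>1 / 2 ^ (j + 1) < u\<close> params by (intro powr_mono2') auto
    also have "(1 / 2 ^ (j + 1)) powr (-\<theta>) = 2 powr (\<theta> * (j + 1))"
    proof -
      have "1 / (2::real) ^ (j + 1) = 2 powr (- real (j + 1))"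
        by (simp only: powr_minus_divide powr_realpow[of 2] zero_less_numeral)
      then show ?thesis by (simp only: powr_powr minus_mult_minus mult.commute)
    qed
    also have "\<dots> = 2 powr \<theta> * 2 powr (\<theta> * j)"
      by (simp add: powr_add distrib_left)
    also have "\<dots> \<le> 4 * 2 powr (\<theta> * j)"
    proof (rule mult_right_mono)
      have "2 powr \<theta> \<le> 2 powr (1::real)" using params by (intro powr_mono) auto
      then show "2 powr \<theta> \<le> (4::real)" by simp
    qed simp
    finally have "norm (LINT r|lborel. indicator {c<..} r *\<^sub>R (K (r + u) * cnj (K r)))
        \<le> B * (4 * 2 powr (\<theta> * j))" using params by (simp add: mult_left_mono)
    also have "\<dots> = 4 * B * 2 powr (\<theta> * j) * indicator {..1 / 2 ^ j} u" using j by simp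
    also have "\<dots> \<le> (\<Sum>j\<le>n. 4 * B * 2 powr (\<theta> * j) * indicator {..1 / 2 ^ j} u)"
      using j params by (intro member_le_sum[of j "{..n}" "\<lambda>j. 4 * B * 2 powr (\<theta> * j) * indicator {..1 / 2 ^ j} u"]) auto
    also have "\<dots> \<le> weight B \<theta> n u" using False params by (simp add: weight_def)
    finally show ?thesis .
  next
    case 3
    have zero: "K (r + u) * cnj (K r) = 0" for r
      using K_supp[of r] K_supp[of "r + u"] 3 eps by (cases "K r = 0") auto
    show ?thesis
      by (simp only: zero scaleR_zero_right Bochner_Integration.integral_zero norm_zero weight_nonneg[OF params(3)])
  qed
  then show ?thesis unfolding eq u_def .
qed

text \<open>Heights \<open>2 powr (\<theta> * j)\<close> against masses
  \<open>6 * \<alpha> / 2 ^ j\<close> form a geometric series of ratio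
  \<open>2 powr (\<theta> - 1) < 1\<close>.\<close>

lemma (in dyadic_stopping) integral_weight_le:
  assumes params: "0 \<le> \<theta>" "\<theta> < 1" "B \<ge> 0"
  shows "(\<integral>\<^sup>+y. indicator {y. n \<le> \<nu> y} y * ennreal (weight B \<theta> n \<bar>y - z\<bar>) \<partial>\<mu>)
    \<le> ennreal (12 * B * \<alpha> * (1 + 2 / (1 - 2 powr (\<theta> - 1))))"
proof (cases "n = 0")
  case True
  then show ?thesis by (simp add: weight_def)
next
  case False
  define A where "A j = {y. n \<le> \<nu> y \<and> \<bar>y - z\<bar> \<le> 1 / 2 ^ j}" for j :: nat
  have A[measurable]: "A j \<in> sets \<mu>" for j unfolding A_def sets_\<mu> by measurable
  have A_le: "emeasure \<mu> (A j) \<le> ennreal (6 * \<alpha> / 2 ^ j)" if "j \<le> n" for j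
    unfolding A_def using emeasure_interval_unstopped[of n j z] False that by simp
  define q where "q = 2 powr (\<theta> - 1)"
  have q: "0 \<le> q" "q < 1"
  proof -
    have "2 powr (\<theta> - 1) < 2 powr (0::real)" using params by (intro powr_less_mono) auto
    then show "q < 1" by (simp add: q_def)
  qed (simp add: q_def)
  have "(\<integral>\<^sup>+y. indicator {y. n \<le> \<nu> y} y * ennreal (weight B \<theta> n \<bar>y - z\<bar>) \<partial>\<mu>)
    = (\<integral>\<^sup>+y. ennreal (2 * B * 2 ^ n) * indicator (A n) y
        + (\<Sum>j\<le>n. ennreal (4 * B * 2 powr (\<theta> * j)) * indicator (A j) y) \<partial>\<mu>)"
  proof (intro nn_integral_cong)
    fix y
    have "ennreal (weight B \<theta> n \<bar>y - z\<bar>) = ennreal (2 * B * 2 ^ n) * indicator {..1 / 2 ^ n} \<bar>y - z\<bar>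
        + (\<Sum>j\<le>n. ennreal (4 * B * 2 powr (\<theta> * j)) * indicator {..1 / 2 ^ j} \<bar>y - z\<bar>)"
      using False params
      by (simp add: weight_def ennreal_plus sum_nonneg ennreal_mult ennreal_indicator flip: sum_ennreal)
    then show "indicator {y. n \<le> \<nu> y} y * ennreal (weight B \<theta> n \<bar>y - z\<bar>)
        = ennreal (2 * B * 2 ^ n) * indicator (A n) y
        + (\<Sum>j\<le>n. ennreal (4 * B * 2 powr (\<theta> * j)) * indicator (A j) y)"
      by (cases "n \<le> \<nu> y") (auto simp: A_def indicator_def)
  qed
  also have "\<dots> = (\<integral>\<^sup>+y. ennreal (2 * B * 2 ^ n) * indicator (A n) y \<partial>\<mu>)
        + (\<integral>\<^sup>+y. (\<Sum>j\<le>n. ennreal (4 * B * 2 powr (\<theta> * j)) * indicator (A j) y) \<partial>\<mu>)"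
    by (rule nn_integral_add) measurable
  also have "(\<integral>\<^sup>+y. (\<Sum>j\<le>n. ennreal (4 * B * 2 powr (\<theta> * j)) * indicator (A j) y) \<partial>\<mu>)
      = (\<Sum>j\<le>n. \<integral>\<^sup>+y. ennreal (4 * B * 2 powr (\<theta> * j)) * indicator (A j) y \<partial>\<mu>)"
    by (rule nn_integral_sum) measurable
  also have "(\<integral>\<^sup>+y. ennreal (2 * B * 2 ^ n) * indicator (A n) y \<partial>\<mu>)
      + (\<Sum>j\<le>n. \<integral>\<^sup>+y. ennreal (4 * B * 2 powr (\<theta> * j)) * indicator (A j) y \<partial>\<mu>)
    = ennreal (2 * B * 2 ^ n) * emeasure \<mu> (A n)
        + (\<Sum>j\<le>n. ennreal (4 * B * 2 powr (\<theta> * j)) * emeasure \<mu> (A j))"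
    by (simp only: nn_integral_cmult_indicator[OF A])
  also have "\<dots> \<le> ennreal (2 * B * 2 ^ n) * ennreal (6 * \<alpha> / 2 ^ n)
        + (\<Sum>j\<le>n. ennreal (4 * B * 2 powr (\<theta> * j)) * ennreal (6 * \<alpha> / 2 ^ j))"
    by (intro add_mono mult_left_mono sum_mono A_le) auto
  also have "\<dots> = ennreal (12 * B * \<alpha> + (\<Sum>j\<le>n. 24 * B * \<alpha> * q ^ j))"
  proof -
    have *: "4 * B * 2 powr (\<theta> * j) * (6 * \<alpha> / 2 ^ j) = 24 * B * \<alpha> * q ^ j" for j :: nat
    proof -
      have "q ^ j = 2 powr (\<theta> * j) / 2 ^ j"
        by (simp add: q_def powr_diff powr_powr[symmetric] powr_realpow power_divide)
      then show ?thesis by simp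
    qed
    have "(\<Sum>j\<le>n. ennreal (4 * B * 2 powr (\<theta> * j)) * ennreal (6 * \<alpha> / 2 ^ j)) = (\<Sum>j\<le>n. ennreal (24 * B * \<alpha> * q ^ j))"
      using params \<alpha> by (intro sum.cong refl) (simp only: *[symmetric], subst ennreal_mult, auto)
    also have "\<dots> = ennreal (\<Sum>j\<le>n. 24 * B * \<alpha> * q ^ j)"
      using params \<alpha> q by (intro sum_ennreal) auto
    moreover have "ennreal (2 * B * 2 ^ n) * ennreal (6 * \<alpha> / 2 ^ n) = ennreal (12 * B * \<alpha>)"
      using params \<alpha> by (simp flip: ennreal_mult)
    ultimately show ?thesis
      using params \<alpha> q by (simp add: sum_nonneg)
  qed
  also have "\<dots> \<le> ennreal (12 * B * \<alpha> * (1 + 2 / (1 - q)))"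
  proof (rule ennreal_leI)
    have "(\<Sum>j\<le>n. q ^ j) \<le> (\<Sum>j. q ^ j)"
      using q by (intro sum_le_suminf summable_geometric) auto
    also have "\<dots> = 1 / (1 - q)" using q by (intro suminf_geometric) auto
    finally have "24 * B * \<alpha> * (\<Sum>j\<le>n. q ^ j) \<le> 24 * B * \<alpha> * (1 / (1 - q))"
      using params \<alpha> by (intro mult_left_mono) auto
    then show "12 * B * \<alpha> + (\<Sum>j\<le>n. 24 * B * \<alpha> * q ^ j) \<le> 12 * B * \<alpha> * (1 + 2 / (1 - q))"
      by (simp add: sum_distrib_left distrib_left)
  qed
  finally show ?thesis by (simp add: q_def)
qed

lemma ennreal_le_divideI:
  assumes "a > 0" "b \<ge> 0" "ennreal a * X \<le> ennreal b"
  shows "X \<le> ennreal (b / a)"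
proof -
  have "X = ennreal (1 / a) * (ennreal a * X)"
    using assms by (simp add: mult.assoc[symmetric] flip: ennreal_mult)
  also have "\<dots> \<le> ennreal (1 / a) * ennreal b"
    using assms by (intro mult_left_mono) auto
  also have "\<dots> = ennreal (b / a)" using assms by (simp flip: ennreal_mult)
  finally show ?thesis .
qed

text \<open>In the constant, \<open>2\<close> comes from the exceptional set and the rest from
  Chebyshev's inequality applied to the square norm bound \<open>2 * c * F\<close>.\<close>

theorem weak_type_of_correlation_bounds:
  fixes K :: "real \<Rightarrow> complex" and f :: "real \<Rightarrow> complex"
  assumes K[measurable]: "K \<in> borel_measurable borel"
    and eps: "\<epsilon> > 0" and K_le: "\<And>x. norm (K x) \<le> 1 / \<epsilon>"
    and K_supp: "\<And>x. K x \<noteq> 0 \<Longrightarrow> \<epsilon> \<le> x \<and> x \<le> 1"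
    and params: "0 \<le> \<theta>" "\<theta> < 1" "B \<ge> 0"
    and far: "\<And>c u. 0 \<le> c \<Longrightarrow> 0 < u \<Longrightarrow> u \<le> 1 \<Longrightarrow>
      norm (LINT r|lborel. indicator {c<..} r *\<^sub>R (K (r + u) * cnj (K r))) \<le> B * u powr (-\<theta>)"
    and near: "\<And>c u. 0 < c \<Longrightarrow> 0 \<le> u \<Longrightarrow>
      norm (LINT r|lborel. indicator {c<..} r *\<^sub>R (K (r + u) * cnj (K r))) \<le> B / c"
    and f: "integrable lborel f" and \<alpha>: "\<alpha> > 0"
  shows "emeasure lborel {x. norm (LINT y|lborel. K (x - y) * f y) > \<alpha>}
    \<le> ennreal ((2 + 24 * B * (1 + 2 / (1 - 2 powr (\<theta> - 1)))) / \<alpha> * (LINT y|lborel. norm (f y)))"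
proof -
  obtain N where N: "1 / 2 ^ N < \<epsilon>"
    using real_arch_pow_inv[of \<epsilon> "1 / 2"] eps by (auto simp: power_divide)
  have fm[measurable]: "f \<in> borel_measurable borel" using f by auto
  define F where "F = (LINT y|lborel. norm (f y))"
  have F: "F \<ge> 0" by (simp add: F_def)
  define \<mu> where "\<mu> = density lborel (\<lambda>y. ennreal (norm (f y)))"
  interpret dyadic_stopping \<mu> \<alpha> N
    by standard (auto simp: \<mu>_def \<alpha>)
  have \<mu>_UNIV: "emeasure \<mu> UNIV = ennreal F"
    unfolding \<mu>_def F_def using f by (subst emeasure_density) (auto simp: nn_integral_eq_integral)
  interpret finite_measure \<mu>
    using \<mu>_UNIV by (intro finite_measureI) (simp add: \<mu>_def)
  interpret P: pair_sigma_finite \<mu> \<mu> ..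
  have \<mu>_integral: "(\<integral>\<^sup>+y. g y \<partial>\<mu>) = (\<integral>\<^sup>+y. ennreal (norm (f y)) * g y \<partial>lborel)"
    if "g \<in> borel_measurable borel" for g :: "real \<Rightarrow> ennreal"
    unfolding \<mu>_def using that by (subst nn_integral_density) auto
  define c where "c = 12 * B * \<alpha> * (1 + 2 / (1 - 2 powr (\<theta> - 1)))"
  have c: "c \<ge> 0"
  proof -
    have "2 powr (\<theta> - 1) < 2 powr (0::real)" using params by (intro powr_less_mono) auto
    then show ?thesis using params \<alpha> by (simp add: c_def)
  qed

  define k where "k x y = truncated K (1 / 2 ^ \<nu> y) (x - y)" for x y
  define S where "S x = (LINT y|lborel. k x y * f y)" for x
  define \<Lambda> where "\<Lambda> y z = (LINT x|lborel. k x y * cnj (k x z))" for y z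
  have h[measurable]: "(\<lambda>y. 1 / 2 ^ \<nu> y :: real) \<in> borel_measurable borel"
    by (rule measurable_compose[OF measurable_\<nu>]) simp
  have k[measurable]: "(\<lambda>(x, y). k x y) \<in> borel_measurable (lborel \<Otimes>\<^sub>M lborel)"
    unfolding k_def truncated_def by measurable
  have k_le: "norm (k x y) \<le> 1 / \<epsilon> * indicator {y..y + 1} x" for x y
    using K_le[of "x - y"] K_supp[of "x - y"] eps
    by (cases "K (x - y) = 0") (auto simp: k_def truncated_def indicator_def)
  have [measurable]: "S \<in> borel_measurable borel" unfolding S_def by measurable
  have cnj_meas[measurable]: "cnj \<in> borel_measurable borel"
    by (intro borel_measurable_continuous_onI continuous_intros)

  \<comment> \<open>A kernel value lost by truncation has \<open>x\<close> within one stopping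
    length to the right of \<open>y\<close>. If the cell of \<open>y\<close> is heavy,
    \<open>x\<close> is exceptional; otherwise that length is below \<open>\<epsilon>\<close>, where
    the kernel vanishes.\<close>
  have T_eq_S: "(LINT y|lborel. K (x - y) * f y) = S x" if x: "x \<notin> exceptional" for x
    unfolding S_def
  proof (intro Bochner_Integration.integral_cong refl)
    fix y
    have "K (x - y) = 0" if "x - y \<le> 1 / 2 ^ \<nu> y"
    proof (rule ccontr)
      assume "K (x - y) \<noteq> 0"
      then have xy: "\<epsilon> \<le> x - y" using K_supp by blast
      show False
      proof (cases "bad (\<nu> y) y")
        case True
        then show False using in_exceptional[of y x] x xy that eps by auto
      next
        case False
        then have "\<nu> y = N" using \<nu>_cases by blast
        then show False using that xy N by auto
      qed
    qed
    then show "K (x - y) * f y = k x y * f y" by (auto simp: k_def truncated_def not_less)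
  qed

  \<comment> \<open>\<open>Z y z\<close> is the majorant when \<open>z\<close> has the longer
    stopping length; one of \<open>Z z y\<close> and \<open>Z y z\<close> covers any pair.\<close>
  define Z where "Z y z = indicator {y. \<nu> z \<le> \<nu> y} y * ennreal (weight B \<theta> (\<nu> z) \<bar>y - z\<bar>)" for y z
  have Z_meas: "case_prod Z \<in> borel_measurable (\<mu> \<Otimes>\<^sub>M \<mu>)"
  proof -
    \<comment> \<open>\<open>\<nu>\<close> takes countably many values, so joint measurability
      reduces to a fixed \<open>n\<close>.\<close>
    have "(\<lambda>p. indicator {y. n \<le> \<nu> y} (fst p) * ennreal (weight B \<theta> n \<bar>fst p - snd p\<bar>)) \<in> borel_measurable (\<mu> \<Otimes>\<^sub>M \<mu>)" for n
      by measurable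
    then have "(\<lambda>p. indicator {y. \<nu> (snd p) \<le> \<nu> y} (fst p) * ennreal (weight B \<theta> (\<nu> (snd p)) \<bar>fst p - snd p\<bar>))
        \<in> borel_measurable (\<mu> \<Otimes>\<^sub>M \<mu>)"
      by (rule measurable_compose_countable) measurable
    then show ?thesis by (simp add: Z_def case_prod_beta')
  qed
  have Z_int: "(\<integral>\<^sup>+y. Z y z \<partial>\<mu>) \<le> ennreal c" for z
    unfolding Z_def c_def by (rule integral_weight_le[OF params])
  have \<Lambda>_le: "ennreal (norm (\<Lambda> y z)) \<le> ennreal (weight B \<theta> (\<nu> z) \<bar>y - z\<bar>)" if "\<nu> z \<le> \<nu> y" for y z
    unfolding \<Lambda>_def k_def
    by (intro ennreal_leI correlation_le_weight[OF eps K_supp params far near that])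
  have \<Lambda>_le_Z: "ennreal (norm (\<Lambda> y z)) \<le> Z z y + Z y z" for y z
  proof (cases "\<nu> z \<le> \<nu> y")
    case True
    then show ?thesis using \<Lambda>_le[OF True] by (simp add: Z_def add_increasing)
  next
    case False
    have "\<Lambda> z y = cnj (\<Lambda> y z)"
      unfolding \<Lambda>_def by (simp add: mult.commute flip: Bochner_Integration.integral_cnj)
    then have "norm (\<Lambda> y z) = norm (\<Lambda> z y)" by simp
    then show ?thesis using \<Lambda>_le[of y z] False by (simp add: Z_def add_increasing2)
  qed

  have \<Lambda>_meas[measurable]: "(\<lambda>(y, z). \<Lambda> y z) \<in> borel_measurable (borel \<Otimes>\<^sub>M borel)"
    unfolding \<Lambda>_def k_def truncated_def by measurable
  have "(\<integral>\<^sup>+x. ennreal ((norm (S x))\<^sup>2) \<partial>lborel)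
      \<le> (\<integral>\<^sup>+y. ennreal (norm (f y)) * (\<integral>\<^sup>+z. ennreal (norm (f z)) * ennreal (norm (\<Lambda> y z)) \<partial>lborel) \<partial>lborel)"
    unfolding S_def \<Lambda>_def by (rule kernel_operator_L2_le[OF k k_le f])
  also have "\<dots> = (\<integral>\<^sup>+y. (\<integral>\<^sup>+z. ennreal (norm (\<Lambda> y z)) \<partial>\<mu>) \<partial>\<mu>)"
    by (simp add: \<mu>_integral)
  also have "\<dots> \<le> (\<integral>\<^sup>+y. (\<integral>\<^sup>+z. Z z y + Z y z \<partial>\<mu>) \<partial>\<mu>)"
    by (intro nn_integral_mono \<Lambda>_le_Z)
  also have "\<dots> = (\<integral>\<^sup>+y. (\<integral>\<^sup>+z. Z z y \<partial>\<mu>) \<partial>\<mu>) + (\<integral>\<^sup>+y. (\<integral>\<^sup>+z. Z y z \<partial>\<mu>) \<partial>\<mu>)"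
  proof -
    have "y \<in> space \<mu>" for y by (simp add: \<mu>_def)
    then have [measurable]: "(\<lambda>z. Z y z) \<in> borel_measurable \<mu>" "(\<lambda>z. Z z y) \<in> borel_measurable \<mu>" for y
      using measurable_compose[OF measurable_Pair1' Z_meas, of y] measurable_compose[OF measurable_Pair2' Z_meas, of y]
      by simp_all
    note [measurable] = Z_meas
    have "(\<integral>\<^sup>+z. Z z y + Z y z \<partial>\<mu>) = (\<integral>\<^sup>+z. Z z y \<partial>\<mu>) + (\<integral>\<^sup>+z. Z y z \<partial>\<mu>)" for y
      by (rule nn_integral_add) measurable
    then show ?thesis by (simp only:) (rule nn_integral_add; measurable)
  qed
  \<comment> \<open>After the exchange the inner variable is the one with the shorter stopping
    length, as \<open>Z_int\<close> requires.\<close>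
  also have "(\<integral>\<^sup>+y. (\<integral>\<^sup>+z. Z y z \<partial>\<mu>) \<partial>\<mu>) = (\<integral>\<^sup>+z. (\<integral>\<^sup>+y. Z y z \<partial>\<mu>) \<partial>\<mu>)"
    by (rule P.Fubini'[OF Z_meas, symmetric])
  also have "(\<integral>\<^sup>+y. (\<integral>\<^sup>+z. Z z y \<partial>\<mu>) \<partial>\<mu>) + (\<integral>\<^sup>+z. (\<integral>\<^sup>+y. Z y z \<partial>\<mu>) \<partial>\<mu>)
      \<le> (\<integral>\<^sup>+y. ennreal c \<partial>\<mu>) + (\<integral>\<^sup>+y. ennreal c \<partial>\<mu>)"
    by (intro add_mono nn_integral_mono Z_int)
  also have "\<dots> = ennreal (2 * c * F)"
    using c F \<mu>_UNIV by (simp add: \<mu>_def flip: ennreal_mult ennreal_plus)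
  finally have L2: "(\<integral>\<^sup>+x. ennreal ((norm (S x))\<^sup>2) \<partial>lborel) \<le> ennreal (2 * c * F)" .

  have "ennreal (\<alpha>\<^sup>2) * emeasure lborel {x. norm (S x) > \<alpha>}
      = (\<integral>\<^sup>+x. ennreal (\<alpha>\<^sup>2) * indicator {x. norm (S x) > \<alpha>} x \<partial>lborel)"
    by (rule nn_integral_cmult_indicator[symmetric]) simp
  also have "\<dots> \<le> (\<integral>\<^sup>+x. ennreal ((norm (S x))\<^sup>2) \<partial>lborel)"
    using \<alpha> by (intro nn_integral_mono) (auto simp: indicator_def intro!: ennreal_leI power_mono)
  finally have "emeasure lborel {x. norm (S x) > \<alpha>} \<le> ennreal (2 * c * F / \<alpha>\<^sup>2)"
    using L2 \<alpha> c F by (intro ennreal_le_divideI) auto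
  moreover have "emeasure lborel exceptional \<le> ennreal (2 * F / \<alpha>)"
  proof (rule ennreal_le_divideI)
    show "ennreal \<alpha> * emeasure lborel exceptional \<le> ennreal (2 * F)"
      using emeasure_exceptional F by (simp add: \<mu>_UNIV ennreal_mult)
  qed (use \<alpha> F in auto)
  moreover have "emeasure lborel {x. norm (LINT y|lborel. K (x - y) * f y) > \<alpha>}
      \<le> emeasure lborel (exceptional \<union> {x. norm (S x) > \<alpha>})"
    using T_eq_S by (intro emeasure_mono) auto
  moreover have "emeasure lborel (exceptional \<union> {x. norm (S x) > \<alpha>})
      \<le> emeasure lborel exceptional + emeasure lborel {x. norm (S x) > \<alpha>}"
    by (rule emeasure_subadditive) auto
  ultimately have "emeasure lborel {x. norm (LINT y|lborel. K (x - y) * f y) > \<alpha>}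
      \<le> ennreal (2 * F / \<alpha>) + ennreal (2 * c * F / \<alpha>\<^sup>2)"
    by (meson add_mono order_trans)
  also have "\<dots> = ennreal (2 * F / \<alpha> + 2 * c * F / \<alpha>\<^sup>2)"
    using \<alpha> c F by (intro ennreal_plus[symmetric]) auto
  also have "2 * F / \<alpha> + 2 * c * F / \<alpha>\<^sup>2 = (2 + 24 * B * (1 + 2 / (1 - 2 powr (\<theta> - 1)))) / \<alpha> * F"
  proof -
    define q where "q = 1 + 2 / (1 - 2 powr (\<theta> - 1))"
    show ?thesis
      unfolding c_def q_def[symmetric] using \<alpha> by (simp add: field_simps power2_eq_square)
  qed
  finally show ?thesis unfolding F_def .
qed

subsection \<open>Oscillating kernels\<close>

theorem mainTheorem2:
  fixes \<gamma> g1 g2 g3 \<psi> p1 p2 :: "real \<Rightarrow> real"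
    and t0 s0 C :: real
  assumes
    \<comment> \<open>gamma is C^3 on (0,1] with derivatives g1, g2, g3\<close>
    gamma_d1: "\<And>t. t \<in> {0<..1} \<Longrightarrow> (\<gamma> has_real_derivative g1 t) (at t within {0<..1})"
    and gamma_d2: "\<And>t. t \<in> {0<..1} \<Longrightarrow> (g1 has_real_derivative g2 t) (at t within {0<..1})"
    and gamma_d3: "\<And>t. t \<in> {0<..1} \<Longrightarrow> (g2 has_real_derivative g3 t) (at t within {0<..1})"
    and gamma_c3: "continuous_on {0<..1} g3"
    and gamma_lim: "filterlim (\<lambda>t. \<bar>\<gamma> t\<bar>) at_top (at_right 0)"
    \<comment> \<open>psi is C^2 on [0,1], positive on (0,1], tends to 0 at 0+\<close>
    and psi_d1: "\<And>t. t \<in> {0..1} \<Longrightarrow> (\<psi> has_real_derivative p1 t) (at t within {0..1})"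
    and psi_d2: "\<And>t. t \<in> {0..1} \<Longrightarrow> (p1 has_real_derivative p2 t) (at t within {0..1})"
    and psi_c2: "continuous_on {0..1} p2"
    and psi_pos: "\<And>t. t \<in> {0<..1} \<Longrightarrow> \<psi> t > 0"
    and psi_lim: "(\<psi> \<longlongrightarrow> 0) (at_right 0)"
    \<comment> \<open>constants\<close>
    and t0_pos: "t0 > 0" and s0_pos: "s0 > 0" and C_pos: "C > 0"
    \<comment> \<open>(a.1)\<close>
    and a1_gamma: "monotone_either {0<..1} \<gamma>"
    and a1_psi: "monotone_either {0..1} \<psi>"
    and a1_g1: "monotone_either {0<..1} g1"
    and a1_g2: "monotone_either {0<..1} g2"
    and a1_p1: "monotone_either {0..1} p1"
    and a1_g1_pos: "\<And>t. t \<in> {0<..1} \<Longrightarrow> g1 t > 0"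
    and a1_g1_decr: "antimono_on {0<..1} g1"
    \<comment> \<open>(a.2)\<close>
    and a2: "\<And>t. 0 < t \<Longrightarrow> t < t0 \<Longrightarrow> t \<le> 1 \<Longrightarrow>
               \<bar>p1 t / \<psi> t\<bar> \<le> 1/2 * \<bar>g3 t / g2 t\<bar>"
    \<comment> \<open>(a.3), with the inverse of gamma' on (0,1]\<close>
    and a3: "\<And>s. s > s0 \<Longrightarrow> s \<ge> g1 1 \<Longrightarrow>
               \<bar>g2 (the_inv_into {0<..1} g1 (2 * s))\<bar>
                 \<le> C * \<bar>g2 (the_inv_into {0<..1} g1 s)\<bar>"
    \<comment> \<open>(a.4)\<close>
    and a4: "\<exists>\<epsilon>>0. \<exists>A>1 + \<epsilon>. \<forall>t. 0 < t \<and> t < t0 \<and> (1 + \<epsilon>) * t \<le> 1 \<longrightarrow>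
               g1 t \<ge> A * g1 ((1 + \<epsilon>) * t)"
    \<comment> \<open>(a.5)\<close>
    and a5: "\<exists>lam. 1/2 < lam \<and> lam < 1 \<and> (\<forall>t. 0 < t \<and> t < t0 \<and> t \<le> 1 \<longrightarrow>
               \<bar>g2 t\<bar> \<le> C * g1 t powr (2 * lam))"
  shows "\<exists>A. \<forall>\<epsilon>>0. \<forall>\<beta>::real. \<forall>f::real \<Rightarrow> complex. integrable lborel f \<longrightarrow>
           (\<forall>\<alpha>>0. emeasure lborel {x. norm (T_op \<gamma> \<psi> \<epsilon> \<beta> f x) > \<alpha>}
                     \<le> ennreal (A * (1 + \<bar>\<beta>\<bar>) / \<alpha> * L1_norm f))"
proof -
  obtain e A where e: "e > 0" "A > 1 + e"
    and decay: "\<And>t. 0 < t \<Longrightarrow> t < t0 \<Longrightarrow> (1 + e) * t \<le> 1 \<Longrightarrow> g1 t \<ge> A * g1 ((1 + e) * t)"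
    using a4 by blast
  obtain lam where lam: "1/2 < lam" "lam < 1"
    and g2_le: "\<And>t. 0 < t \<Longrightarrow> t < t0 \<Longrightarrow> t \<le> 1 \<Longrightarrow> \<bar>g2 t\<bar> \<le> C * g1 t powr (2 * lam)"
    using a5 by blast
  obtain c a where c: "c > 0" "a > 1" and growth: "\<And>r. r \<in> {0<..1} \<Longrightarrow> g1 r \<ge> c * r powr (-a)"
    using power_growth_of_geometric_decay[OF a1_g1_pos a1_g1_decr t0_pos e decay] by blast
  note unbounded = growth_excludes_bounded_derivative[OF gamma_d2 growth c]
  \<comment> \<open>A decreasing \<open>g2\<close> would be bounded below by \<open>g2 1\<close>,
    which the growth of \<open>g1\<close> forbids.\<close>
  have g2_mono: "mono_on {0<..1} g2"
  proof (rule ccontr)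
    assume "\<not> mono_on {0<..1} g2"
    then have anti: "antimono_on {0<..1} g2" using a1_g2 by (auto simp: monotone_either_def)
    obtain t where t: "t \<in> {0<..1}" "g2 t < - \<bar>g2 1\<bar>" using unbounded by blast
    have "g2 t \<ge> g2 1" using monotone_onD[OF anti t(1), of 1] t by auto
    with t show False by linarith
  qed
  obtain \<tau> where \<tau>: "\<tau> \<in> {0<..1}" "g2 \<tau> < 0" using unbounded[of 0] by auto
  \<comment> \<open>Up to \<open>t1\<close> the hypotheses for \<open>t < t0\<close> apply,
    \<open>g2\<close> is negative by comparison with \<open>\<tau>\<close>, and a dilation by
    \<open>1 + e\<close> stays in \<open>{0<..1}\<close>.\<close>
  define t1 where "t1 = min (min (t0 / 2) (1 / 2)) (min \<tau> (1 / (1 + e)))"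
  have t1: "0 < t1" "t1 < 1" "t1 < t0" "t1 \<le> \<tau>" "t1 \<le> 1 / (1 + e)"
    using \<tau> t0_pos e by (auto simp: t1_def min_less_iff_disj)
  have "g2 t1 < 0" using monotone_onD[OF g2_mono, of t1 \<tau>] \<tau> t1 by auto
  have et: "(1 + e) * r \<le> 1" if "r \<le> t1" for r
    using mult_left_mono[of r "1 / (1 + e)" "1 + e"] that t1 e by simp
  \<comment> \<open>The growth exponent \<open>a > 1\<close> is shared out: the power
    \<open>\<kappa>\<close> of \<open>1 / g1\<close> is kept as the weight that makes
    \<open>V\<close> bounded, and the rest still yields a power
    \<open>b = a * (1 - \<kappa>)\<close> above \<open>1\<close>.\<close>
  define \<kappa> b where "\<kappa> = (a - 1) / (2 * a)" and "b = (a + 1) / 2"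
  define c0 C1 where "c0 = (1 - 1 / A) * min 1 (1 / e)" and "C1 = c powr (\<kappa> - 1)"
  have \<kappa>: "\<kappa> > 0" "\<kappa> < 1" "b > 1" "a * (1 - \<kappa>) = b"
    using c by (auto simp: \<kappa>_def b_def field_simps)
  have c0: "c0 > 0" "C1 > 0" using e c by (auto simp: c0_def C1_def min_def field_simps)
  have gap: "c0 * u * g1 r \<le> (r + u) * (g1 r - g1 (r + u))"
    if "0 < r" "r \<le> t1" "0 < u" "r + u \<le> 1" for r u
    unfolding c0_def
    by (rule increment_lower_bound[OF gamma_d2 g2_mono a1_g1_pos a1_g1_decr e])
       (use that t1 et decay in auto)
  have g1_inv: "1 / g1 r \<le> C1 * r powr b * g1 r powr (-\<kappa>)" if r: "0 < r" "r \<le> t1" for r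
  proof -
    have r1: "r \<in> {0<..1}" using r t1 by auto
    have "g1 r powr (\<kappa> - 1) \<le> (c * r powr (-a)) powr (\<kappa> - 1)"
      using growth[OF r1] c r \<kappa> by (intro powr_mono2') auto
    also have "\<dots> = C1 * r powr (a * (1 - \<kappa>))"
      using c r by (simp add: C1_def powr_mult powr_powr algebra_simps)
    finally have "g1 r powr (\<kappa> - 1) \<le> C1 * r powr b" using \<kappa> by simp
    then have "g1 r powr (\<kappa> - 1) * g1 r powr (-\<kappa>) \<le> C1 * r powr b * g1 r powr (-\<kappa>)"
      by (intro mult_right_mono) auto
    moreover have "g1 r powr (\<kappa> - 1) * g1 r powr (-\<kappa>) = 1 / g1 r"
      using a1_g1_pos[OF r1] powr_add[of "g1 r" "\<kappa> - 1" "-\<kappa>"] by (simp add: powr_minus_divide)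
    ultimately show ?thesis by simp
  qed
  define p where "p t = p1 t / \<psi> t" for t
  define L where "L t = ln (\<psi> t)" for t
  have psi_d: "(\<psi> has_real_derivative p1 t) (at t within {0<..1})" if "t \<in> {0<..1}" for t
    using that by (intro has_field_derivative_subset[OF psi_d1]) auto
  have dL: "(L has_real_derivative p t) (at t within {0<..1})" if "t \<in> {0<..1}" for t
    unfolding L_def p_def using psi_d[OF that] psi_pos[OF that]
    by (auto intro!: derivative_eq_intros)
  have cont: "continuous_on {0<..1} \<gamma>" "continuous_on {0<..1} g1" "continuous_on {0<..1} \<psi>"
    by (rule DERIV_continuous_on, rule gamma_d1 gamma_d2 psi_d, assumption)+
  have "continuous_on {0..1} p1"
    by (rule DERIV_continuous_on) (rule psi_d2)
  then have cont_p: "continuous_on {0<..1} p"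
    unfolding p_def using psi_pos cont(3)
    by (intro continuous_on_divide) (auto intro: continuous_on_subset simp: less_imp_neq[symmetric])
  have pos: "\<forall>t\<in>{0<..1}. \<psi> t > 0" using psi_pos by blast
  \<comment> \<open>\<open>a2\<close> and \<open>a5\<close> enter here, to control the logarithmic
    derivative of \<open>\<psi>\<close> in weighted mean.\<close>
  obtain V M where dV: "\<And>t. t \<in> {0<..1} \<Longrightarrow>
        (V has_real_derivative \<bar>p t\<bar> * g1 t powr (-\<kappa>)) (at t within {0<..1})"
    and V: "\<And>t. t \<in> {0<..1} \<Longrightarrow> - M \<le> V t \<and> V t \<le> 0"
    using bounded_weighted_primitive[OF gamma_d3 g2_mono a1_g1_pos cont_p cont(2) t1(1,2) \<open>g2 t1 < 0\<close>, of C lam \<kappa>]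
      a2 g2_le C_pos lam \<kappa> t1 by (force simp: p_def)
  have M: "M \<ge> 0" using V[of 1] by simp
  define Z where "Z = C1 / c0 * (3 * g1 1 powr (-\<kappa>) + 4 * g1 1 powr (-\<kappa>) / (b - 1) + 2 * M)"
  have Z: "Z \<ge> 0" unfolding Z_def using c0 M \<kappa> by simp
  define \<theta> where "\<theta> = 1 / b"
  have \<theta>: "0 \<le> \<theta>" "\<theta> < 1" using \<kappa> by (auto simp: \<theta>_def)
  define \<Phi> where "\<Phi> \<beta> x = \<gamma> x - \<beta> * ln x + \<beta> * L x" for \<beta> x
  have cont_\<Phi>: "continuous_on {0<..1} (\<Phi> \<beta>)" for \<beta>
    unfolding \<Phi>_def L_def using pos by (intro continuous_intros cont) force+
  have cont_\<Theta>: "continuous_on {x..y} (\<lambda>r. \<Phi> \<beta> (r + u) - \<Phi> \<beta> r)"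
    if "0 < x" "0 \<le> u" "y + u \<le> 1" for \<beta> x y u
    using that by (intro continuous_intros continuous_on_compose2[OF cont_\<Phi>]) auto
  \<comment> \<open>\<open>B\<close> depends on neither \<open>\<epsilon>\<close> nor
    \<open>\<beta>\<close> nor the endpoints, which is the source of the uniformity.\<close>
  define B where "B = Z + 1 + 1 / t1"
  have B: "B \<ge> 1" using Z t1 by (simp add: B_def)
  have corr: "norm (integral {x..y} (\<lambda>r. cis (\<Phi> \<beta> (r + u) - \<Phi> \<beta> r) / of_real (r * (r + u))))
      \<le> B * (1 + \<bar>\<beta>\<bar>) * u powr (- \<theta>)" if xy: "0 < x" "x \<le> y" "0 < u" "y + u \<le> 1" for x y u \<beta>
  proof -
    have "norm (integral {x..y} (\<lambda>r. cis (\<Phi> \<beta> (r + u) - \<Phi> \<beta> r) / of_real (r * (r + u))))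
      \<le> (Z * (1 + \<bar>\<beta>\<bar>) + 1 + 1 / t1) * u powr (- (1 / b))"
    proof (rule correlation_integral_bound)
      fix d assume d: "x \<le> d" "d \<le> t1" "d + u \<le> 1"
      show "norm (integral {x..d} (\<lambda>r. cis (\<Phi> \<beta> (r + u) - \<Phi> \<beta> r) / of_real (r * (r + u))))
        \<le> Z * (1 + \<bar>\<beta>\<bar>) * (d powr (b - 1) / u)"
        unfolding \<Phi>_def Z_def using \<kappa> c0 t1 d xy
        by (intro correlation_integral_near_zero[OF gamma_d1 gamma_d2 dL dV V g2_mono a1_g1_pos a1_g1_decr gap g1_inv])
           auto
    qed (use cont_\<Theta>[of x u y] xy t1 \<kappa> Z in auto)
    also have "\<dots> \<le> B * (1 + \<bar>\<beta>\<bar>) * u powr (- (1 / b))"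
    proof (rule mult_right_mono)
      have "(1 + 1 / t1) * 1 \<le> (1 + 1 / t1) * (1 + \<bar>\<beta>\<bar>)" using t1 by (intro mult_left_mono) auto
      then show "Z * (1 + \<bar>\<beta>\<bar>) + 1 + 1 / t1 \<le> B * (1 + \<bar>\<beta>\<bar>)" by (simp add: B_def algebra_simps)
    qed simp
    finally show ?thesis by (simp add: \<theta>_def)
  qed
  define k where "k = 1 + 2 / (1 - 2 powr (\<theta> - 1))"
  have k: "k \<ge> 0"
  proof -
    have "2 powr (\<theta> - 1) < 2 powr (0::real)" using \<theta> by (intro powr_less_mono) auto
    then show ?thesis by (simp add: k_def)
  qed
  show ?thesis
  proof (intro exI[of _ "2 + 24 * B * k"] allI impI)
    fix \<epsilon> \<beta> \<alpha> :: real and f :: "real \<Rightarrow> complex"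
    assume \<epsilon>: "\<epsilon> > 0" and f: "integrable lborel f" and \<alpha>: "\<alpha> > 0"
    let ?K = "K_kernel \<gamma> \<psi> \<epsilon> \<beta>"
    \<comment> \<open>The loss \<open>1 + \<bar>\<beta>\<bar>\<close> sits in the correlation
      constant, on which the weak type bound depends affinely; with
      \<open>2 \<le> 2 * (1 + \<bar>\<beta>\<bar>)\<close> this explains the witness.\<close>
    define B' where "B' = B * (1 + \<bar>\<beta>\<bar>)"
    have B': "B' \<ge> 1" using mult_mono[OF B, of 1 "1 + \<bar>\<beta>\<bar>"] B by (simp add: B'_def)
    have corr_eq: "(LINT r|lborel. indicator {c<..} r *\<^sub>R (?K (r + u) * cnj (?K r)))
        = integral {max c \<epsilon>..1 - u} (\<lambda>r. cis (\<Phi> \<beta> (r + u) - \<Phi> \<beta> r) / of_real (r * (r + u)))"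
      if "0 \<le> c" "0 \<le> u" for c u
      using correlation_K_kernel[OF pos \<epsilon> that(2,1) cont(1,3)] by (simp add: \<Phi>_def L_def)
    have "emeasure lborel {x. norm (LINT y|lborel. ?K (x - y) * f y) > \<alpha>}
        \<le> ennreal ((2 + 24 * B' * (1 + 2 / (1 - 2 powr (\<theta> - 1)))) / \<alpha> * (LINT y|lborel. norm (f y)))"
    proof (rule weak_type_of_correlation_bounds[OF _ \<epsilon> _ _ \<theta> _ _ _ f \<alpha>])
      show "?K \<in> borel_measurable borel" by (rule K_kernel_measurable[OF pos \<epsilon> cont(1,3)])
      show "norm (?K x) \<le> 1 / \<epsilon>" for x by (rule K_kernel_norm_le[OF pos \<epsilon>])
      show "?K x \<noteq> 0 \<Longrightarrow> \<epsilon> \<le> x \<and> x \<le> 1" for x by (auto simp: K_kernel_def split: if_splits)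
      show "0 \<le> B'" using B' by simp
      show "norm (LINT r|lborel. indicator {c<..} r *\<^sub>R (?K (r + u) * cnj (?K r))) \<le> B' * u powr (-\<theta>)"
        if "0 \<le> c" "0 < u" "u \<le> 1" for c u
      \<comment> \<open>When \<open>max c \<epsilon> > 1 - u\<close> the interval is empty and the
        correlation is zero.\<close>
      proof (cases "max c \<epsilon> \<le> 1 - u")
        case True
        then show ?thesis using corr[of "max c \<epsilon>" "1 - u" u \<beta>] \<epsilon> that
          by (simp add: corr_eq B'_def)
      next
        case False
        then show ?thesis using that B' by (simp add: corr_eq)
      qed
      show "norm (LINT r|lborel. indicator {c<..} r *\<^sub>R (?K (r + u) * cnj (?K r))) \<le> B' / c"
        if "0 < c" "0 \<le> u" for c u
      proof (cases "max c \<epsilon> \<le> 1 - u")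
        case True
        have "norm (integral {max c \<epsilon>..1 - u} (\<lambda>r. cis (\<Phi> \<beta> (r + u) - \<Phi> \<beta> r) / of_real (r * (r + u))))
            \<le> 1 / max c \<epsilon>"
          using True that \<epsilon> by (intro correlation_integral_trivial cont_\<Theta>) auto
        also have "\<dots> \<le> B' / c" using that B' by (intro frac_le) auto
        finally show ?thesis using that by (simp add: corr_eq)
      next
        case False
        then show ?thesis using that B' by (simp add: corr_eq)
      qed
    qed
    also have "\<dots> \<le> ennreal ((2 + 24 * B * k) * (1 + \<bar>\<beta>\<bar>) / \<alpha> * (LINT y|lborel. norm (f y)))"
    proof (intro ennreal_leI mult_right_mono divide_right_mono)
      have "(2 + 24 * B * k) * (1 + \<bar>\<beta>\<bar>) = 2 * (1 + \<bar>\<beta>\<bar>) + 24 * B' * k"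
        by (simp add: B'_def algebra_simps)
      then show "2 + 24 * B' * (1 + 2 / (1 - 2 powr (\<theta> - 1))) \<le> (2 + 24 * B * k) * (1 + \<bar>\<beta>\<bar>)"
        by (simp add: k_def)
    qed (use \<alpha> in auto)
    finally show "emeasure lborel {x. norm (T_op \<gamma> \<psi> \<epsilon> \<beta> f x) > \<alpha>}
        \<le> ennreal ((2 + 24 * B * k) * (1 + \<bar>\<beta>\<bar>) / \<alpha> * L1_norm f)"
      by (simp add: T_op_def L1_norm_def)
  qed
qed

end
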